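(* Every $n$-vertex $5$-ary tree has a straight-line drawing with ply-number at most $2\log n$ and area $O(n^{7.2})$.
   Context: A $5$-ary tree is a rooted tree in which every vertex has at most $5$ children (equivalently, a tree of maximum degree at most $6$). In a straight-line drawing $\Gamma$ of a graph, the ply-disk $D_v$ of a vertex $v$ is the open disk centered at $v$ whose radius $r_v$ is half the length of the longest edge incident to $v$; for $q\in\mathbb{R}^2$ let $S_q=\{D_v:\|v-q\|<r_v\}$; the ply-number of $\Gamma$ is $\max_{q\in\mathbb{R}^2}|S_q|$. The area of a drawing is the area of the smallest axis-aligned rectangle containing it, under the resolution rule that every edge has length at least $1$. Logarithms are base $2$. *)

theory Defs
  imports
    "HOL-Analysis.Analysis"
    "HOL-Library.Landau_Symbols"
    "Graph_Theory.Arc_Walk"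
begin

section \<open>Rooted trees\<close>

text \<open>
  Arcs point from parent to child. Uniqueness of the walk from the root rules out cycles
  (directed or undirected), loops and parallel arcs, so \<open>out_degree T v\<close> is the number of
  children of \<open>v\<close>.
\<close>

definition rooted_tree :: "('a, 'b) pre_digraph \<Rightarrow> 'a \<Rightarrow> bool" where
  "rooted_tree T r \<longleftrightarrow>
     fin_digraph T \<and> r \<in> verts T \<and> (\<forall>v \<in> verts T. \<exists>!p. pre_digraph.awalk T r p v)"

definition k_ary_tree :: "nat \<Rightarrow> ('a, 'b) pre_digraph \<Rightarrow> 'a \<Rightarrow> bool" where
  "k_ary_tree k T r \<longleftrightarrow> rooted_tree T r \<and> (\<forall>v \<in> verts T. out_degree T v \<le> k)"


section \<open>Straight-line drawings\<close>

text \<open>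
  A drawing is given by the positions of the vertices; the orientation of the arcs is
  irrelevant. Edges may cross, but no edge passes through a vertex other than its endpoints.
\<close>

definition edge_segment :: "('a, 'b) pre_digraph \<Rightarrow> ('a \<Rightarrow> real^2) \<Rightarrow> 'b \<Rightarrow> (real^2) set" where
  "edge_segment G \<Gamma> e = closed_segment (\<Gamma> (tail G e)) (\<Gamma> (head G e))"

definition edge_length :: "('a, 'b) pre_digraph \<Rightarrow> ('a \<Rightarrow> real^2) \<Rightarrow> 'b \<Rightarrow> real" where
  "edge_length G \<Gamma> e = dist (\<Gamma> (tail G e)) (\<Gamma> (head G e))"

definition straight_line_drawing :: "('a, 'b) pre_digraph \<Rightarrow> ('a \<Rightarrow> real^2) \<Rightarrow> bool" where
  "straight_line_drawing G \<Gamma> \<longleftrightarrow>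
     inj_on \<Gamma> (verts G) \<and>
     (\<forall>e \<in> arcs G. \<forall>v \<in> verts G.
        \<Gamma> v \<in> edge_segment G \<Gamma> e \<longrightarrow> v = tail G e \<or> v = head G e)"

definition incident_edges :: "('a, 'b) pre_digraph \<Rightarrow> 'a \<Rightarrow> 'b set" where
  "incident_edges G v = {e \<in> arcs G. tail G e = v \<or> head G e = v}"


section \<open>Ply-disks and ply-number\<close>

text \<open>Inserting \<open>0\<close> only matters for an isolated vertex: its open ply-disk is empty.\<close>

definition ply_radius :: "('a, 'b) pre_digraph \<Rightarrow> ('a \<Rightarrow> real^2) \<Rightarrow> 'a \<Rightarrow> real" where
  "ply_radius G \<Gamma> v = Max (insert 0 (edge_length G \<Gamma> ` incident_edges G v)) / 2"

definition ply_disk :: "('a, 'b) pre_digraph \<Rightarrow> ('a \<Rightarrow> real^2) \<Rightarrow> 'a \<Rightarrow> (real^2) set" where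
  "ply_disk G \<Gamma> v = ball (\<Gamma> v) (ply_radius G \<Gamma> v)"

definition disks_at :: "('a, 'b) pre_digraph \<Rightarrow> ('a \<Rightarrow> real^2) \<Rightarrow> real^2 \<Rightarrow> (real^2) set set" where
  "disks_at G \<Gamma> q = {ply_disk G \<Gamma> v | v. v \<in> verts G \<and> norm (\<Gamma> v - q) < ply_radius G \<Gamma> v}"

text \<open>For finite \<open>G\<close> the maximum is over a finite set of values, as
  \<open>card (disks_at G \<Gamma> q) \<le> card (verts G)\<close>.\<close>

definition ply_number :: "('a, 'b) pre_digraph \<Rightarrow> ('a \<Rightarrow> real^2) \<Rightarrow> nat" where
  "ply_number G \<Gamma> = (MAX q. card (disks_at G \<Gamma> q))"


section \<open>Resolution and area\<close>

definition satisfies_resolution_rule :: "('a, 'b) pre_digraph \<Rightarrow> ('a \<Rightarrow> real^2) \<Rightarrow> bool" where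
  "satisfies_resolution_rule G \<Gamma> \<longleftrightarrow> (\<forall>e \<in> arcs G. edge_length G \<Gamma> e \<ge> 1)"

definition drawing_points :: "('a, 'b) pre_digraph \<Rightarrow> ('a \<Rightarrow> real^2) \<Rightarrow> (real^2) set" where
  "drawing_points G \<Gamma> = \<Gamma> ` verts G \<union> (\<Union>e \<in> arcs G. edge_segment G \<Gamma> e)"

text \<open>For a bounded set this is the smallest axis-aligned closed rectangle containing it
  (possibly degenerate).\<close>

definition bounding_box :: "(real^2) set \<Rightarrow> (real^2) set" where
  "bounding_box S = \<Inter> {cbox a b | a b. S \<subseteq> cbox a b}"

definition drawing_area :: "('a, 'b) pre_digraph \<Rightarrow> ('a \<Rightarrow> real^2) \<Rightarrow> real" where
  "drawing_area G \<Gamma> = measure lborel (bounding_box (drawing_points G \<Gamma>))"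

end

theory Submission
  imports Defs
begin

text \<open>
  Draw a heavy path of the tree on the x-axis. At each of its vertices the at most four light
  children are attached in the directions \<open>\<plusminus>60\<close> and \<open>\<plusminus>120\<close> degrees, at distance \<open>2 \<rho>\<close>, and
  their subtrees are drawn recursively, rotated accordingly, in the disks of radius \<open>\<rho>\<close> around
  them, where \<open>\<rho> = 66 k powr 3.6\<close> for the size \<open>k\<close> of the largest light subtree at that vertex.
  Path gaps that vary at most by a factor of about 2 keep each such disk away from all path
  ply-disks except that of the attaching vertex, and any point away from all but two path
  ply-disks. A light subtree has at most half of the vertices, so each level of the recursion
  adds at most 2 to the ply: one path ply-disk, and the ply-disk of the light child, enlarged by
  the arc from its parent.

  A light subtree of size \<open>k\<close> contributes at most \<open>32/3 \<rho>\<close> to the length of the path. Along a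
  heavy path, \<open>k powr 3.6\<close> sums up to at most \<open>n powr 3.6 / (2 powr 3.6 - 1)\<close>, and
  \<open>32/3 < 11 \<le> 2 powr 3.6 - 1\<close>. Hence the whole drawing fits in a disk of radius
  \<open>66 n powr 3.6\<close>.
\<close>

section \<open>Growth estimates for the exponent 3.6\<close>

lemma two_powr_36: "(12::real) \<le> 2 powr 3.6"
proof (rule ccontr)
  assume "\<not> ?thesis"
  \<comment> \<open>As 3.6 = 18/5, fifth powers turn the claim into 12^5 = 248832 \<le> 262144 =
    2^18.\<close>
  hence "(2 powr 3.6 :: real) ^ 5 < 12 ^ 5"
    by (intro power_strict_mono) auto
  moreover have "(2 powr 3.6 :: real) ^ 5 = 2 powr 18"
    by (simp add: powr_powr flip: powr_realpow)
  moreover have "(2::real) powr 18 = 2 ^ 18"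
    by (subst powr_realpow [symmetric]) auto
  ultimately show False by simp
qed

text \<open>The left side is convex in \<open>a\<close>, so between 0 and \<open>n / 2\<close> it
  stays below its chord. At 0 it equals the right side; at \<open>n / 2\<close> it is
  \<open>12 * (n / 2) powr 3.6\<close>, which \<open>two_powr_36\<close> bounds. On a heavy path
  \<open>a\<close> is the size of the largest light subtree, and \<open>n - a\<close> bounds the
  size of the heavy one.\<close>

lemma powr_chord_step:
  fixes a n :: real
  assumes a: "0 \<le> a" "2 * a \<le> n"
  shows "11 * a powr 3.6 + (n - a) powr 3.6 \<le> n powr 3.6"
proof (cases "n = 0")
  case False
  with a have n: "n > 0" by simp
  define t where "t = 2 * a / n"
  have t: "0 \<le> t" "t \<le> 1" using a n by (auto simp: t_def field_simps)
  have at: "a = t * (n / 2)" using n by (simp add: t_def)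
  have half: "12 * (n / 2) powr 3.6 \<le> n powr 3.6"
  proof -
    have "n powr 3.6 = 2 powr 3.6 * (n / 2) powr 3.6"
      using n by (subst powr_mult [symmetric]) auto
    thus ?thesis using mult_right_mono [OF two_powr_36, of "(n/2) powr 3.6"] by simp
  qed
  have "t powr 3.6 \<le> t"
    using powr_mono' [of 1 "3.6" t] t by (cases "t = 0") auto
  hence 1: "a powr 3.6 \<le> t * (n / 2) powr 3.6"
    unfolding at using t n by (subst powr_mult) (auto intro!: mult_right_mono)
  have "convex_on {0<..} (\<lambda>x::real. x powr 3.6)"
    by (rule powr_convex) auto
  from convex_onD [OF this, of t n "n/2"] n t
  have 2: "((1 - t) * n + t * (n / 2)) powr 3.6 \<le> (1 - t) * n powr 3.6 + t * (n / 2) powr 3.6"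
    by simp
  have "(1 - t) * n + t * (n / 2) = n - a" unfolding at by (simp add: algebra_simps)
  with 2 have "(n - a) powr 3.6 \<le> (1 - t) * n powr 3.6 + t * (n / 2) powr 3.6" by simp
  moreover have "t * (12 * (n / 2) powr 3.6) \<le> t * n powr 3.6"
    using half t by (intro mult_left_mono) auto
  ultimately show ?thesis using 1 by (simp add: algebra_simps)
qed (use a in auto)

section \<open>Spacing the vertices of a path\<close>

text \<open>
  The horizontal gaps between consecutive vertices of a path are a two-sided exponential
  smoothing of the radii \<open>\<rho>\<close> required at the vertices. The weight \<open>8/3\<close> is the least for
  which a gap exceeds half of an adjacent gap by \<open>2 \<rho>\<close>.
\<close>
lemma smoothed_gaps_exist:
  fixes \<rho> :: "nat \<Rightarrow> real"
  assumes \<rho>: "\<And>i. 0 \<le> \<rho> i" and van: "\<And>i. m < i \<Longrightarrow> \<rho> i = 0"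
  obtains d :: "nat \<Rightarrow> real" where
    "\<And>i. 1 \<le> d i"
    "\<And>i. d i / 2 + 2 * \<rho> (Suc i) \<le> d (Suc i)"
    "\<And>i. d (Suc (Suc i)) / 2 + 2 * \<rho> i \<le> d (Suc i)"
    "d (Suc 0) / 2 \<le> d 0"
    "8/3 * \<rho> 0 \<le> d 0"
    "\<And>i. 8/3 * \<rho> i + 8/3 * \<rho> (Suc i) \<le> d (Suc i)"
    "(\<Sum>i<Suc (Suc m). d (Suc i)) \<le> real (m + 2) + 32/3 * (\<Sum>i\<le>m. \<rho> i)"
proof -
  \<comment> \<open>\<open>A i\<close> sums the radii before index \<open>i\<close>,
    \<open>B i\<close> those from \<open>i\<close> on, halved with every step of distance. Gap
    \<open>d i\<close> separates the vertices \<open>i - 1\<close> and \<open>i\<close>, so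
    \<open>A\<close> looks left from it and \<open>B\<close> looks right.\<close>
  define A where "A = rec_nat 0 (\<lambda>i a. \<rho> i + a / 2)"
  have A0: "A 0 = 0" and AS: "A (Suc i) = \<rho> i + A i / 2" for i by (simp_all add: A_def)
  define B where "B i = (\<Sum>j\<in>{i..m}. \<rho> j / 2 ^ (j - i))" for i
  have BS: "B i = \<rho> i + B (Suc i) / 2" for i
  proof (cases "i \<le> m")
    case True
    have "B i = \<rho> i + (\<Sum>j\<in>{Suc i..m}. \<rho> j / 2 ^ (j - i))"
      unfolding B_def using True by (subst sum.atLeast_Suc_atMost) auto
    also have "(\<Sum>j\<in>{Suc i..m}. \<rho> j / 2 ^ (j - i)) = B (Suc i) / 2"
      unfolding B_def sum_divide_distrib by (rule sum.cong) (auto simp: Suc_diff_le [symmetric] simp flip: power_Suc2)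
    finally show ?thesis .
  qed (auto simp: B_def van)
  have A: "0 \<le> A i" for i by (induction i) (auto simp: A0 AS \<rho>)
  have B: "0 \<le> B i" for i unfolding B_def by (intro sum_nonneg) (auto simp: \<rho>)
  have sumA: "(\<Sum>i<k. A (Suc i)) + A k = 2 * (\<Sum>i<k. \<rho> i)" for k
    by (induction k) (auto simp: A0 AS algebra_simps)
  have sumB: "(\<Sum>i<k. B i) = 2 * (\<Sum>i<k. \<rho> i) + B k - B 0" for k
  proof (induction k)
    case (Suc k)
    thus ?case using BS [of k] by simp
  qed simp
  define d where "d i = 1 + 8/3 * (A i + B i)" for i
  have d: "3 * d i = 3 + 8 * A i + 8 * B i" for i by (simp add: d_def)
  have B0: "B i = 0" if "m < i" for i using that by (simp add: B_def)
  show ?thesis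
  proof (rule that [of d])
    show "1 \<le> d i" for i using A [of i] B [of i] by (simp add: d_def)
    \<comment> \<open>With weight c in place of 8/3, \<open>d (Suc i) - d i / 2\<close> is at least
      \<open>3/4 * c * B (Suc i)\<close>, hence at least \<open>3/4 * c * \<rho> (Suc i)\<close>; c
      = 8/3 makes the factor 2. The next bound is the mirror image, with \<open>A\<close> for
      \<open>B\<close>.\<close>
    show "d i / 2 + 2 * \<rho> (Suc i) \<le> d (Suc i)" for i
      using AS [of i] BS [of i] BS [of "Suc i"] B [of "Suc (Suc i)"] \<rho> [of i]
        d [of i] d [of "Suc i"] d [of "Suc (Suc i)"] by linarith
    show "d (Suc (Suc i)) / 2 + 2 * \<rho> i \<le> d (Suc i)" for i
      using AS [of i] AS [of "Suc i"] BS [of "Suc i"] A [of i] \<rho> [of "Suc i"]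
        d [of i] d [of "Suc i"] d [of "Suc (Suc i)"] by linarith
    show "d (Suc 0) / 2 \<le> d 0" using AS [of 0] BS [of 0] A0 \<rho> [of 0] d [of 0] d [of "Suc 0"] by linarith
    show "8/3 * \<rho> 0 \<le> d 0" using BS [of 0] A0 B [of "Suc 0"] d [of 0] d [of "Suc 0"] by linarith
    show "8/3 * \<rho> i + 8/3 * \<rho> (Suc i) \<le> d (Suc i)" for i
      using AS [of i] BS [of "Suc i"] A [of i] B [of "Suc (Suc i)"]
        d [of i] d [of "Suc i"] d [of "Suc (Suc i)"] by linarith
    \<comment> \<open>Each radius enters the sums of \<open>A\<close> and of \<open>B\<close> with
      geometric weights of total at most 2, and 8/3 * (2 + 2) = 32/3.\<close>
    let ?k = "Suc (Suc m)"
    have "(\<Sum>i<?k. d (Suc i)) = real (m + 2) + 8/3 * ((\<Sum>i<?k. A (Suc i)) + (\<Sum>i<?k. B (Suc i)))"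
      unfolding d_def sum.distrib sum_distrib_left [symmetric] by (simp add: algebra_simps)
    also have "(\<Sum>i<?k. A (Suc i)) \<le> 2 * (\<Sum>i<?k. \<rho> i)" using sumA [of ?k] A [of ?k] by linarith
    also have "(\<Sum>i<?k. B (Suc i)) \<le> (\<Sum>i<Suc ?k. B i)"
      using B [of 0] unfolding sum.lessThan_Suc_shift [of _ ?k] by simp
    also have "\<dots> \<le> 2 * (\<Sum>i<Suc ?k. \<rho> i)" using sumB [of "Suc ?k"] B [of 0] B0 [of "Suc ?k"] by simp
    finally have "(\<Sum>i<?k. d (Suc i)) \<le> real (m + 2) + 8/3 * (2 * (\<Sum>i<?k. \<rho> i) + 2 * (\<Sum>i<Suc ?k. \<rho> i))"
      by simp
    also have "(\<Sum>i<?k. \<rho> i) = (\<Sum>i\<le>m. \<rho> i)" using van by (simp add: lessThan_Suc_atMost)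
    also have "(\<Sum>i<Suc ?k. \<rho> i) = (\<Sum>i\<le>m. \<rho> i)" using van by (simp add: lessThan_Suc_atMost)
    finally show "(\<Sum>i<?k. d (Suc i)) \<le> real (m + 2) + 32/3 * (\<Sum>i\<le>m. \<rho> i)" by simp
  qed
qed

section \<open>Heavy paths\<close>

text \<open>With one fixed parent-child relation, the recursion only changes the vertex whose
  subtree is drawn.\<close>

locale quinary_forest =
  fixes E :: "('a \<times> 'a) set"
  assumes finite_E: "finite E"
    and acyclic_E: "acyclic E"
    and parent_unique: "(a, c) \<in> E \<Longrightarrow> (b, c) \<in> E \<Longrightarrow> a = b"
    and card_children: "card (E `` {a}) \<le> 5"
begin

definition subtree :: "'a \<Rightarrow> 'a set" where
  "subtree a = E\<^sup>* `` {a}"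

lemma in_subtree_self [simp]: "a \<in> subtree a"
  by (simp add: subtree_def)

lemma finite_children [simp]: "finite (E `` {a})"
  using finite_E by (rule finite_Image)

lemma finite_subtree [simp]: "finite (subtree a)"
proof (rule finite_subset)
  show "subtree a \<subseteq> insert a (Range E)"
    unfolding subtree_def by (auto elim: rtranclE)
qed (use finite_E in \<open>simp add: finite_Range\<close>)

lemma subtree_mono: "b \<in> subtree a \<Longrightarrow> subtree b \<subseteq> subtree a"
  unfolding subtree_def by (auto intro: rtrancl_trans)

lemma child_in_subtree: "b \<in> subtree a \<Longrightarrow> (b, c) \<in> E \<Longrightarrow> c \<in> subtree a"
  unfolding subtree_def by (auto intro: rtrancl_into_rtrancl)

lemma subtree_child_subset: "(a, c) \<in> E \<Longrightarrow> subtree c \<subseteq> subtree a"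
  unfolding subtree_def by (auto intro: converse_rtrancl_into_rtrancl)

lemma not_in_subtree_child: "(a, c) \<in> E \<Longrightarrow> a \<notin> subtree c"
  using acyclic_E unfolding subtree_def acyclic_def by (auto dest: rtrancl_into_trancl2)

lemma subtree_unfold: "subtree a = insert a (\<Union>c\<in>E `` {a}. subtree c)"
  unfolding subtree_def
  by (auto elim: converse_rtranclE intro: converse_rtrancl_into_rtrancl)

lemma card_subtree_pos: "0 < card (subtree a)"
  using in_subtree_self [of a] by (auto simp: card_gt_0_iff simp del: in_subtree_self)

text \<open>Parents being unique, the walks from \<open>a\<close> and from \<open>b\<close> down to
  \<open>w\<close> agree when traced upwards from \<open>w\<close>, until the shorter one
  ends.\<close>

lemma subtrees_nested:
  assumes "w \<in> subtree a" "w \<in> subtree b"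
  shows "a \<in> subtree b \<or> b \<in> subtree a"
proof -
  have "(a, w) \<in> E\<^sup>*" "(b, w) \<in> E\<^sup>*" using assms by (auto simp: subtree_def)
  hence "(a, b) \<in> E\<^sup>* \<or> (b, a) \<in> E\<^sup>*"
  proof (induction arbitrary: b rule: rtrancl_induct)
    case (step y z)
    from step.prems show ?case
    proof (cases rule: rtranclE)
      case base
      thus ?thesis using step.hyps by (blast intro: rtrancl_into_rtrancl)
    next
      case (step y')
      thus ?thesis using parent_unique step.IH \<open>(y, z) \<in> E\<close> by blast
    qed
  qed auto
  thus ?thesis by (auto simp: subtree_def)
qed

text \<open>Otherwise one sibling lies strictly below the other. The walk down to it passes through
  its parent \<open>a\<close>, which would then lie in the subtree of a child of its own.\<close>

lemma sibling_subtrees_disjoint: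
  assumes "(a, c) \<in> E" "(a, c') \<in> E" "c \<noteq> c'"
  shows "subtree c \<inter> subtree c' = {}"
proof -
  have False if "x \<in> subtree y" "(a, x) \<in> E" "(a, y) \<in> E" "x \<noteq> y" for x y
  proof -
    from that have "(y, x) \<in> E\<^sup>*" by (simp add: subtree_def)
    then obtain z where "(y, z) \<in> E\<^sup>*" "(z, x) \<in> E" using \<open>x \<noteq> y\<close> by (auto elim: rtranclE)
    hence "a \<in> subtree y" using parent_unique that by (auto simp: subtree_def)
    thus False using not_in_subtree_child that by blast
  qed
  thus ?thesis using subtrees_nested assms by fast
qed

lemma card_subtree_child: "(a, c) \<in> E \<Longrightarrow> card (subtree c) < card (subtree a)"
proof (rule psubset_card_mono)
  assume "(a, c) \<in> E"
  thus "subtree c \<subset> subtree a"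
    using not_in_subtree_child [of a c] subtree_child_subset [of a c] in_subtree_self [of a] by blast
qed simp

lemma card_sibling_subtrees:
  assumes "(a, c) \<in> E" "(a, c') \<in> E" "c \<noteq> c'"
  shows "card (subtree c) + card (subtree c') < card (subtree a)"
proof -
  have "card (subtree c) + card (subtree c') = card (subtree c \<union> subtree c')"
    using sibling_subtrees_disjoint [OF assms] by (simp add: card_Un_disjoint)
  also have "\<dots> < card (subtree a)"
  proof (rule psubset_card_mono)
    have "a \<notin> subtree c \<union> subtree c'" using assms not_in_subtree_child by auto
    moreover have "subtree c \<union> subtree c' \<subseteq> subtree a"
      using assms subtree_child_subset by blast
    ultimately show "subtree c \<union> subtree c' \<subset> subtree a" using in_subtree_self [of a] by blast
  qed simp
  finally show ?thesis .
qed

text \<open>\<open>h\<close> will be the next vertex of the path. Past its end the path takes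
  arbitrary values, but the last vertex is a leaf, so the value there is 0 for any
  \<open>h\<close>.\<close>

definition max_light :: "'a \<Rightarrow> 'a \<Rightarrow> nat" where
  "max_light a h = Max (insert 0 ((\<lambda>c. card (subtree c)) ` (E `` {a} - {h})))"

lemma card_le_max_light: "(a, c) \<in> E \<Longrightarrow> c \<noteq> h \<Longrightarrow> card (subtree c) \<le> max_light a h"
  unfolding max_light_def by (intro Max_ge) auto

lemma max_light_cases:
  obtains "max_light a h = 0"
  | c where "(a, c) \<in> E" "c \<noteq> h" "max_light a h = card (subtree c)"
proof -
  have "max_light a h \<in> insert 0 ((\<lambda>c. card (subtree c)) ` (E `` {a} - {h}))"
    unfolding max_light_def by (rule Max_in) auto
  thus ?thesis using that by auto
qed

lemma max_light_leaf: "E `` {a} = {} \<Longrightarrow> max_light a h = 0"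
  by (simp add: max_light_def)

text \<open>Continue from \<open>v\<close> to a child \<open>h\<close> with the largest subtree, of
  size k. The largest light size M at \<open>v\<close> satisfies M \<le> k and M + k < n, so 2 M
  \<le> n. By induction the terms from \<open>h\<close> on are bounded by \<open>k powr 3.6\<close>,
  hence by \<open>(n - M) powr 3.6\<close>, and \<open>powr_chord_step\<close> absorbs the term of
  M.\<close>

lemma heavy_path_exists:
  "\<exists>p m. p 0 = v \<and> (\<forall>i<m. (p i, p (Suc i)) \<in> E) \<and> E `` {p m} = {} \<and>
     m < card (subtree v) \<and>
     (\<forall>i\<le>m. 2 * max_light (p i) (p (Suc i)) \<le> card (subtree v)) \<and>
     11 * (\<Sum>i\<le>m. real (max_light (p i) (p (Suc i))) powr 3.6) \<le> real (card (subtree v)) powr 3.6"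
proof (induction "card (subtree v)" arbitrary: v rule: less_induct)
  case less
  show ?case
  proof (cases "E `` {v} = {}")
    case True
    show ?thesis
      by (rule exI [of _ "\<lambda>_. v"], rule exI [of _ 0])
        (auto simp: max_light_leaf [OF True] True card_subtree_pos)
  next
    case False
    let ?S = "(\<lambda>c. card (subtree c)) ` (E `` {v})"
    have "Max ?S \<in> ?S" using False by (intro Max_in) auto
    then obtain h where "(v, h) \<in> E" "card (subtree h) = Max ?S" by auto
    hence h: "(v, h) \<in> E" "\<And>c. (v, c) \<in> E \<Longrightarrow> card (subtree c) \<le> card (subtree h)"
      by (auto intro!: Max_ge)
    let ?M = "max_light v h" and ?n = "card (subtree v)" and ?k = "card (subtree h)"
    have M: "?M \<le> ?k" "?M + ?k < ?n"
      using h(2) card_subtree_child [OF h(1)] card_sibling_subtrees [OF _ h(1)]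
      by (cases rule: max_light_cases [of v h]; force)+
    from less.hyps [OF card_subtree_child [OF h(1)]] obtain p m where
      p: "p 0 = h" "\<forall>i<m. (p i, p (Suc i)) \<in> E" "E `` {p m} = {}" "m < ?k"
        "\<forall>i\<le>m. 2 * max_light (p i) (p (Suc i)) \<le> ?k"
        "11 * (\<Sum>i\<le>m. real (max_light (p i) (p (Suc i))) powr 3.6) \<le> real ?k powr 3.6"
      by blast
    let ?p = "case_nat v p"
    have "11 * (\<Sum>i\<le>Suc m. real (max_light (?p i) (?p (Suc i))) powr 3.6)
        = 11 * real ?M powr 3.6 + 11 * (\<Sum>i\<le>m. real (max_light (p i) (p (Suc i))) powr 3.6)"
      unfolding sum.atMost_Suc_shift using p(1) by (simp add: algebra_simps)
    also have "\<dots> \<le> 11 * real ?M powr 3.6 + (real ?n - real ?M) powr 3.6"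
      using p(6) M powr_mono2 [of "3.6" "real ?k" "real ?n - real ?M"] by simp
    also have "\<dots> \<le> real ?n powr 3.6"
      using M by (intro powr_chord_step) linarith+
    finally have "11 * (\<Sum>i\<le>Suc m. real (max_light (?p i) (?p (Suc i))) powr 3.6) \<le> real ?n powr 3.6" .
    moreover have "\<forall>i\<le>Suc m. 2 * max_light (?p i) (?p (Suc i)) \<le> ?n"
    proof (intro allI impI)
      fix i assume "i \<le> Suc m"
      show "2 * max_light (?p i) (?p (Suc i)) \<le> ?n"
      proof (cases i)
        case (Suc j)
        thus ?thesis using p(5) \<open>i \<le> Suc m\<close> M by (auto dest!: spec [of _ j])
      qed (use p(1) M in auto)
    qed
    moreover have "\<forall>i<Suc m. (?p i, ?p (Suc i)) \<in> E"
      using p(1,2) h(1) by (auto simp: less_Suc_eq_0_disj)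
    moreover have "Suc m < ?n" using p(4) card_subtree_child [OF h(1)] by linarith
    ultimately show ?thesis
      using p(3) by (intro exI [of _ ?p] exI [of _ "Suc m"]) auto
  qed
qed

end

section \<open>Geometry of the heavy-path layout\<close>

text \<open>The sixth roots of unity except 1 and -1, which are the directions of the path.\<close>

definition hex_directions :: "complex set" where
  "hex_directions = {Complex (1/2) (sqrt 3 / 2), Complex (1/2) (- sqrt 3 / 2),
     Complex (- 1/2) (sqrt 3 / 2), Complex (- 1/2) (- sqrt 3 / 2)}"

lemma card_hex_directions: "card hex_directions = 4" "finite hex_directions"
  by (simp_all add: hex_directions_def)

lemma hex_direction_simps:
  assumes "\<omega> \<in> hex_directions"
  shows "\<bar>Re \<omega>\<bar> = 1/2" "\<bar>Im \<omega>\<bar> = sqrt 3 / 2" "(Im \<omega>)\<^sup>2 = 3/4" "cmod \<omega> = 1"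
  using assms by (auto simp: hex_directions_def cmod_def power_divide)

lemma hex_directions_dot_le:
  assumes "\<omega> \<in> hex_directions" "\<omega>' \<in> hex_directions" "\<omega> \<noteq> \<omega>'"
  shows "Re \<omega> * Re \<omega>' + Im \<omega> * Im \<omega>' \<le> 1/2"
  using assms by (auto simp: hex_directions_def)

lemma hex_direction_rotate:
  assumes "\<omega> \<in> hex_directions"
  shows "cmod (\<omega> * a - \<omega> * b) = cmod (a - b)" "\<omega> * a = \<omega> * b \<longleftrightarrow> a = b"
  using hex_direction_simps(4) [OF assms]
  by (auto simp: norm_mult simp flip: right_diff_distrib)

text \<open>The law of cosines for sides \<open>t\<close> and \<open>2 * \<rho>\<close> that enclose
  an angle of at least 60 degrees.\<close>

lemma hex_directions_dist_ge:
  assumes "\<omega> \<in> hex_directions" "\<omega>' \<in> hex_directions" "\<omega> \<noteq> \<omega>'" "0 \<le> t" "0 \<le> \<rho>"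
  shows "(cmod (of_real t * \<omega> - 2 * of_real \<rho> * \<omega>'))\<^sup>2 \<ge> t\<^sup>2 + 4 * \<rho>\<^sup>2 - 2 * t * \<rho>"
proof -
  have n: "(Re w)\<^sup>2 + (Im w)\<^sup>2 = 1" if "w \<in> hex_directions" for w
    using hex_direction_simps(4) [OF that] cmod_power2 [of w] by simp
  define c where "c = t * \<rho> * (Re \<omega> * Re \<omega>' + Im \<omega> * Im \<omega>')"
  have "c \<le> t * \<rho> * (1/2)"
    unfolding c_def using assms by (intro mult_left_mono hex_directions_dot_le) auto
  moreover have "(cmod (of_real t * \<omega> - 2 * of_real \<rho> * \<omega>'))\<^sup>2
      = t\<^sup>2 * ((Re \<omega>)\<^sup>2 + (Im \<omega>)\<^sup>2) + 4 * \<rho>\<^sup>2 * ((Re \<omega>')\<^sup>2 + (Im \<omega>')\<^sup>2) - 4 * c"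
    unfolding cmod_power2 c_def by (simp add: power2_eq_square algebra_simps)
  ultimately show ?thesis
    unfolding n [OF assms(1)] n [OF assms(2)] by (simp add: mult.commute)
qed

locale smoothed_gaps =
  fixes d \<rho> :: "nat \<Rightarrow> real"
  assumes \<rho>_nonneg: "0 \<le> \<rho> i"
    and gap_ge_1: "1 \<le> d i"
    and gap_Suc: "d i / 2 + 2 * \<rho> (Suc i) \<le> d (Suc i)"
    and gap_Suc': "d (Suc (Suc i)) / 2 + 2 * \<rho> i \<le> d (Suc i)"
    and gap_0: "d (Suc 0) / 2 \<le> d 0"
    and gap_0_ge: "8/3 * \<rho> 0 \<le> d 0"
    and gap_Suc_ge: "8/3 * \<rho> i + 8/3 * \<rho> (Suc i) \<le> d (Suc i)"
begin

text \<open>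
  The vertices of a heavy path will be at \<open>x 0, \<dots>, x m\<close>, so \<open>d 0\<close> and \<open>d (Suc m)\<close> are no arc
  lengths; they only keep the bounds uniform at the two ends.
\<close>

definition x :: "nat \<Rightarrow> real" where "x i = (\<Sum>k<i. d (Suc k))"

definition r :: "nat \<Rightarrow> real" where "r i = max (d i) (d (Suc i)) / 2"

lemma x_0 [simp]: "x 0 = 0" and x_Suc: "x (Suc i) = x i + d (Suc i)"
  by (simp_all add: x_def)

lemma gap_pos: "0 < d i"
  using gap_ge_1 [of i] by simp

lemma gap_half: "d i / 2 \<le> d (Suc i)" "d (Suc i) / 2 \<le> d i"
  using gap_Suc [of i] \<rho>_nonneg [of "Suc i"] gap_0 gap_Suc' [of "i - 1"] \<rho>_nonneg [of "i - 1"]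
  by (auto, cases i, auto)

lemma r_le: "r i \<le> d i" "r i \<le> d (Suc i)"
  using gap_half [of i] gap_pos [of i] gap_pos [of "Suc i"] by (auto simp: r_def)

text \<open>The arcs to light children have length \<open>2 * \<rho> i\<close>, so they do not
  enlarge the ply-disk of the path vertex.\<close>

lemma \<rho>_le_r: "\<rho> i \<le> r i"
  using gap_Suc_ge [of i] \<rho>_nonneg [of i] \<rho>_nonneg [of "Suc i"] by (auto simp: r_def)

lemma gap_le_r: "d i \<le> 2 * r i" "d (Suc i) \<le> 2 * r i"
  by (auto simp: r_def)

lemma x_strict_mono: "strict_mono x"
  by (simp add: strict_mono_Suc_iff x_Suc gap_pos)

lemma x_mono: "i \<le> j \<Longrightarrow> x i \<le> x j"
  using x_strict_mono by (simp add: strict_mono_less_eq)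

lemma x_nonneg: "0 \<le> x i"
  using x_mono [of 0 i] by simp

lemma x_gap': "i < j \<Longrightarrow> x i + d j \<le> x j"
  using x_mono [of i "j - 1"] x_Suc [of "j - 1"] by simp

lemma x_gaps: "Suc i < j \<Longrightarrow> x i + d (Suc i) + d j \<le> x j"
  using x_gap' [of "Suc i" j] by (simp add: x_Suc)

text \<open>By \<open>r_le\<close> the radius of a path disk is at most either gap at its centre.
  Between nonconsecutive vertices the gap next to one differs from the gap next to the
  other.\<close>

lemma far_path_disks: "Suc i < j \<Longrightarrow> x i + r i \<le> x j - r j"
  using x_gaps [of i j] r_le [of i] r_le [of j] by linarith

lemma gap_ge: "8/3 * \<rho> i \<le> d i" "8/3 * \<rho> i \<le> d (Suc i)"
  using gap_Suc_ge [of i] gap_Suc_ge [of "i - 1"] gap_0_ge \<rho>_nonneg [of "Suc i"] \<rho>_nonneg [of "i - 1"]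
  by (auto, cases i, auto)

text \<open>Separates the light subtrees of different path vertices: by \<open>module_slab\<close>
  they are drawn in vertical strips of these half-widths.\<close>

lemma slabs_disjoint: "i < j \<Longrightarrow> x i + 2 * \<rho> i \<le> x j - 2 * \<rho> j"
proof -
  assume "i < j"
  consider "j = Suc i" | "Suc i < j" using \<open>i < j\<close> by linarith
  thus ?thesis
  proof cases
    case 1
    thus ?thesis using gap_Suc_ge [of i] \<rho>_nonneg [of i] \<rho>_nonneg [of j] by (simp add: x_Suc)
  next
    case 2
    thus ?thesis using x_gaps [of i j] gap_ge(2) [of i] gap_ge(1) [of j]
      \<rho>_nonneg [of i] \<rho>_nonneg [of j] by linarith
  qed
qed

text \<open>\<open>r j\<close> is half of one of the two gaps at \<open>j\<close>. If that gap lies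
  on the side of \<open>i\<close>, the second alternative holds. If it lies on the far side, the
  bounds between consecutive gaps leave room for \<open>2 * \<rho> i\<close> as well.\<close>

lemma path_disk_cases:
  assumes "i \<noteq> j"
  shows "2 * \<rho> i + r j \<le> \<bar>x i - x j\<bar> \<or> r j \<le> \<bar>x i - x j\<bar> / 2"
proof (cases "i < j")
  case True
  have r: "r j = d j / 2 \<or> r j = d (Suc j) / 2" by (auto simp: r_def max_def)
  have D: "\<bar>x i - x j\<bar> = x j - x i" using x_mono [of i j] True by simp
  consider "j = Suc i" | "Suc i < j" using True by linarith
  thus ?thesis unfolding D
  proof cases
    case 1
    thus "2 * \<rho> i + r j \<le> x j - x i \<or> r j \<le> (x j - x i) / 2"
      using r gap_Suc' [of i] by (auto simp: x_Suc)
  next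
    case 2
    thus "2 * \<rho> i + r j \<le> x j - x i \<or> r j \<le> (x j - x i) / 2"
      using r x_gaps [of i j] gap_ge(2) [of i] gap_half(2) [of j] \<rho>_nonneg [of i] gap_pos [of "Suc i"]
      by auto
  qed
next
  case False
  hence "j < i" using assms by simp
  have r: "r j = d j / 2 \<or> r j = d (Suc j) / 2" by (auto simp: r_def max_def)
  have D: "\<bar>x i - x j\<bar> = x i - x j" using x_mono [of j i] \<open>j < i\<close> by simp
  consider "i = Suc j" | "Suc j < i" using \<open>j < i\<close> by linarith
  thus ?thesis unfolding D
  proof cases
    case 1
    thus "2 * \<rho> i + r j \<le> x i - x j \<or> r j \<le> (x i - x j) / 2"
      using r gap_Suc [of j] by (auto simp: x_Suc)
  next
    case 2
    thus "2 * \<rho> i + r j \<le> x i - x j \<or> r j \<le> (x i - x j) / 2"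
      using r x_gaps [of j i] gap_ge(1) [of i] gap_half(1) [of j] \<rho>_nonneg [of i] gap_pos [of i]
      by auto
  qed
qed

text \<open>The position of a light child of path vertex \<open>i\<close>. The open disk of radius
  \<open>\<rho> i\<close> around it, reserved for the subtree of that child, is called a module
  below.\<close>

definition centre :: "nat \<Rightarrow> complex \<Rightarrow> complex" where
  "centre i \<omega> = of_real (x i) + 2 * of_real (\<rho> i) * \<omega>"

context
  fixes \<omega> z :: complex and i :: nat
  assumes \<omega>: "\<omega> \<in> hex_directions" and z: "cmod (z - centre i \<omega>) < \<rho> i"
begin

lemma module_slab: "\<bar>Re z - x i\<bar> < 2 * \<rho> i"
proof -
  have "\<bar>2 * \<rho> i * Re \<omega>\<bar> = \<rho> i"
    using hex_direction_simps(1) [OF \<omega>] \<rho>_nonneg [of i] by (simp add: abs_mult)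
  moreover have "Re z - x i = Re (z - centre i \<omega>) + 2 * \<rho> i * Re \<omega>" by (simp add: centre_def)
  ultimately show ?thesis using abs_Re_le_cmod [of "z - centre i \<omega>"] z by linarith
qed

text \<open>The centre has distance \<open>sqrt 3 * \<rho> i\<close> from the line of the path, at
  least the radius of the open module.\<close>

lemma module_Im_nonzero: "Im z \<noteq> 0"
proof
  assume "Im z = 0"
  have "\<bar>2 * \<rho> i * Im \<omega>\<bar> = sqrt 3 * \<rho> i"
    using hex_direction_simps(2) [OF \<omega>] \<rho>_nonneg [of i] by (simp add: abs_mult)
  moreover have "Im (z - centre i \<omega>) = - (2 * \<rho> i * Im \<omega>)"
    using \<open>Im z = 0\<close> by (simp add: centre_def)
  moreover have "1 * \<rho> i \<le> sqrt 3 * \<rho> i" using \<rho>_nonneg by (intro mult_right_mono) auto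
  ultimately show False using abs_Im_le_cmod [of "z - centre i \<omega>"] z by linarith
qed

text \<open>It suffices that the centre of the module has distance at least
  \<open>\<rho> i + r j\<close> from path vertex \<open>j\<close>. The worst angle at path vertex
  \<open>i\<close> is 60 degrees, and the law of cosines bounds the squared distance by
  \<open>D\<^sup>2 - 2 * \<rho> i * D + 4 * (\<rho> i)\<^sup>2\<close> from below.\<close>

lemma module_misses_path_disk:
  assumes "i \<noteq> j"
  shows "r j \<le> cmod (of_real (x j) - z)"
proof -
  define D where "D = \<bar>x i - x j\<bar>"
  have r: "0 \<le> r j" using gap_le_r(1) [of j] gap_pos [of j] by linarith
  have D: "0 \<le> D" by (simp add: D_def)
  have eq: "Re (centre i \<omega> - of_real (x j)) = x i - x j + 2 * \<rho> i * Re \<omega>"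
    "Im (centre i \<omega> - of_real (x j)) = 2 * \<rho> i * Im \<omega>"
    by (simp_all add: centre_def)
  have "(cmod (centre i \<omega> - of_real (x j)))\<^sup>2 = (x i - x j + 2 * \<rho> i * Re \<omega>)\<^sup>2 + 3 * (\<rho> i)\<^sup>2"
    unfolding cmod_power2 eq using hex_direction_simps(3) [OF \<omega>]
    by (simp add: power_mult_distrib)
  also have "\<dots> \<ge> D\<^sup>2 - 2 * \<rho> i * D + 4 * (\<rho> i)\<^sup>2"
  proof -
    have Re: "Re \<omega> = 1/2 \<or> Re \<omega> = - 1/2" using hex_direction_simps(1) [OF \<omega>] by linarith
    have "- (\<rho> i * D) \<le> \<rho> i * (x i - x j)" "\<rho> i * (x i - x j) \<le> \<rho> i * D"
      using mult_left_mono [of "- D" "x i - x j" "\<rho> i"] mult_left_mono [of "x i - x j" D "\<rho> i"]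
        \<rho>_nonneg [of i] by (auto simp: D_def)
    moreover have "(x i - x j + 2 * \<rho> i * Re \<omega>)\<^sup>2 = D\<^sup>2 + 4 * (\<rho> i * (x i - x j)) * Re \<omega> + 4 * (\<rho> i)\<^sup>2 * (Re \<omega>)\<^sup>2"
      by (simp add: D_def power2_eq_square algebra_simps)
    ultimately show ?thesis
      by (rule_tac disjE [OF Re]) (simp_all only: power_divide power2_minus minus_divide_left [symmetric], simp_all add: mult.commute)
  qed
  also have "D\<^sup>2 - 2 * \<rho> i * D + 4 * (\<rho> i)\<^sup>2 \<ge> (\<rho> i + r j)\<^sup>2"
  proof -
    from path_disk_cases [OF assms] consider "2 * \<rho> i + r j \<le> D" | "r j \<le> D / 2"
      by (auto simp: D_def)
    thus ?thesis
    proof cases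
      case 1
      have "0 \<le> (D + r j) * (D - r j - 2 * \<rho> i)" using 1 r D by (intro mult_nonneg_nonneg) auto
      moreover have "D\<^sup>2 - 2 * \<rho> i * D + 4 * (\<rho> i)\<^sup>2
          = (\<rho> i + r j)\<^sup>2 + (D + r j) * (D - r j - 2 * \<rho> i) + 3 * (\<rho> i)\<^sup>2"
        by (simp add: power2_eq_square algebra_simps)
      ultimately show ?thesis using zero_le_power2 [of "\<rho> i"] by linarith
    next
      case 2
      have "(\<rho> i + r j)\<^sup>2 \<le> (\<rho> i + D / 2)\<^sup>2"
        using 2 r \<rho>_nonneg [of i] by (intro power_mono) auto
      \<comment> \<open>The difference of the two sides is 3/4 times the square of
        \<open>D - 2 * \<rho> i\<close>.\<close>
      also have "\<dots> \<le> D\<^sup>2 - 2 * \<rho> i * D + 4 * (\<rho> i)\<^sup>2"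
        using zero_le_power2 [of "D - 2 * \<rho> i"] by (simp add: power2_eq_square algebra_simps)
      finally show ?thesis .
    qed
  qed
  finally have "\<rho> i + r j \<le> cmod (centre i \<omega> - of_real (x j))"
    by (rule power2_le_imp_le) simp
  also have "\<dots> \<le> cmod (z - centre i \<omega>) + cmod (of_real (x j) - z)"
    using dist_triangle [of "centre i \<omega>" "of_real (x j)" z]
    by (simp add: dist_norm norm_minus_commute)
  finally show ?thesis using z by linarith
qed

text \<open>A spoke is an arc from a path vertex to a light child. By
  \<open>hex_directions_dist_ge\<close> the squared distance from the centre to the ray is at least
  \<open>(t - \<rho> i)\<^sup>2 + 3 * (\<rho> i)\<^sup>2\<close>.\<close>

lemma module_misses_spoke:
  assumes "\<omega>' \<in> hex_directions" "\<omega>' \<noteq> \<omega>" "0 \<le> t"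
  shows "z \<noteq> of_real (x i) + of_real t * \<omega>'"
proof
  assume "z = of_real (x i) + of_real t * \<omega>'"
  hence eq: "z - centre i \<omega> = of_real t * \<omega>' - 2 * of_real (\<rho> i) * \<omega>"
    by (simp add: centre_def)
  have "(\<rho> i)\<^sup>2 \<le> t\<^sup>2 + 4 * (\<rho> i)\<^sup>2 - 2 * t * \<rho> i"
  proof -
    have "0 \<le> (t - \<rho> i)\<^sup>2 + 2 * (\<rho> i)\<^sup>2" by simp
    also have "\<dots> = (t\<^sup>2 + 4 * (\<rho> i)\<^sup>2 - 2 * t * \<rho> i) - (\<rho> i)\<^sup>2"
      by (simp add: power2_eq_square algebra_simps)
    finally show ?thesis by (simp only: diff_ge_0_iff_ge)
  qed
  also have "\<dots> \<le> (cmod (z - centre i \<omega>))\<^sup>2"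
    unfolding eq by (rule hex_directions_dist_ge) (use assms \<omega> \<rho>_nonneg in auto)
  finally have "\<rho> i \<le> cmod (z - centre i \<omega>)"
    by (rule power2_le_imp_le) simp
  with z show False by simp
qed

end

text \<open>Modules at different path vertices lie in disjoint strips. At the same path vertex,
  centres in different directions are at least \<open>2 * \<rho> i\<close> apart, the sum of the
  radii.\<close>

lemma module_unique:
  assumes \<omega>: "\<omega> \<in> hex_directions" "\<omega>' \<in> hex_directions"
    and z: "cmod (z - centre i \<omega>) < \<rho> i" "cmod (z - centre j \<omega>') < \<rho> j"
  shows "i = j" "\<omega> = \<omega>'"
proof -
  show "i = j"
    using module_slab [OF \<omega>(1) z(1)] module_slab [OF \<omega>(2) z(2)]
      slabs_disjoint [of i j] slabs_disjoint [of j i]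
    by (cases i j rule: linorder_cases) linarith+
  show "\<omega> = \<omega>'"
  proof (rule ccontr)
    assume ne: "\<omega> \<noteq> \<omega>'"
    have "(2 * \<rho> i)\<^sup>2 \<le> (cmod (of_real (2 * \<rho> i) * \<omega> - 2 * of_real (\<rho> i) * \<omega>'))\<^sup>2"
      using hex_directions_dist_ge [OF \<omega> ne, of "2 * \<rho> i" "\<rho> i"] \<rho>_nonneg [of i]
      by (simp add: power2_eq_square)
    hence "2 * \<rho> i \<le> cmod (of_real (2 * \<rho> i) * \<omega> - 2 * of_real (\<rho> i) * \<omega>')"
      by (rule power2_le_imp_le) simp
    also have "\<dots> = cmod (centre i \<omega> - centre i \<omega>')"
      by (simp add: centre_def)
    also have "\<dots> \<le> cmod (z - centre i \<omega>) + cmod (z - centre i \<omega>')"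
      by (metis dist_commute dist_norm dist_triangle2)
    finally show False using z \<open>i = j\<close> by simp
  qed
qed

end

section \<open>Recursive drawings\<close>

text \<open>The constant solves C = 32/3 * C/11 + 2: the radii along a path sum up to at most C/11
  times \<open>n powr 3.6\<close>, and the unit part of the gaps costs at most twice that
  power.\<close>

definition drawing_radius :: "nat \<Rightarrow> real" where
  "drawing_radius n = 66 * real n powr 3.6"

lemma drawing_radius_mono: "k \<le> n \<Longrightarrow> drawing_radius k \<le> drawing_radius n"
  by (simp add: drawing_radius_def powr_mono2)

lemma drawing_radius_nonneg: "0 \<le> drawing_radius n"
  by (simp add: drawing_radius_def)

lemma drawing_radius_ge: "0 < n \<Longrightarrow> 66 \<le> drawing_radius n"
  by (simp add: drawing_radius_def ge_one_powr_ge_zero)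

context quinary_forest
begin

text \<open>
  \<open>rad\<close> bounds the ply-radii within the subtree of \<open>v\<close>, ignoring the arc into \<open>v\<close>. The condition
  on the negative real axis leaves room for that arc.
\<close>
definition good_drawing :: "'a \<Rightarrow> ('a \<Rightarrow> complex) \<Rightarrow> ('a \<Rightarrow> real) \<Rightarrow> bool" where
  "good_drawing v \<Gamma> rad \<longleftrightarrow>
     \<Gamma> v = 0 \<and>
     (\<forall>w\<in>subtree v. cmod (\<Gamma> w) < drawing_radius (card (subtree v))) \<and>
     (\<forall>w\<in>subtree v. cmod (\<Gamma> w) + rad w \<le> drawing_radius (card (subtree v))) \<and>
     inj_on \<Gamma> (subtree v) \<and>
     (\<forall>a b. (a, b) \<in> E \<longrightarrow> a \<in> subtree v \<longrightarrow>
        1 \<le> dist (\<Gamma> a) (\<Gamma> b) \<and> dist (\<Gamma> a) (\<Gamma> b) \<le> 2 * rad a \<and> dist (\<Gamma> a) (\<Gamma> b) \<le> 2 * rad b) \<and>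
     (\<forall>a b w. (a, b) \<in> E \<longrightarrow> a \<in> subtree v \<longrightarrow> w \<in> subtree v \<longrightarrow>
        \<Gamma> w \<in> closed_segment (\<Gamma> a) (\<Gamma> b) \<longrightarrow> w = a \<or> w = b) \<and>
     (\<forall>w\<in>subtree v. Im (\<Gamma> w) = 0 \<longrightarrow> Re (\<Gamma> w) \<le> 0 \<longrightarrow> w = v) \<and>
     (\<forall>q. real (card {w \<in> subtree v. cmod (\<Gamma> w - q) < rad w}) \<le> 2 * log 2 (card (subtree v)))"

lemma good_drawingD:
  assumes "good_drawing v \<Gamma> rad"
  shows "\<Gamma> v = 0"
    and "w \<in> subtree v \<Longrightarrow> cmod (\<Gamma> w) < drawing_radius (card (subtree v))"
    and "w \<in> subtree v \<Longrightarrow> cmod (\<Gamma> w) + rad w \<le> drawing_radius (card (subtree v))"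
    and "inj_on \<Gamma> (subtree v)"
    and "(a, b) \<in> E \<Longrightarrow> a \<in> subtree v \<Longrightarrow>
      1 \<le> dist (\<Gamma> a) (\<Gamma> b) \<and> dist (\<Gamma> a) (\<Gamma> b) \<le> 2 * rad a \<and> dist (\<Gamma> a) (\<Gamma> b) \<le> 2 * rad b"
    and "(a, b) \<in> E \<Longrightarrow> a \<in> subtree v \<Longrightarrow> w \<in> subtree v \<Longrightarrow>
      \<Gamma> w \<in> closed_segment (\<Gamma> a) (\<Gamma> b) \<Longrightarrow> w = a \<or> w = b"
    and "w \<in> subtree v \<Longrightarrow> Im (\<Gamma> w) = 0 \<Longrightarrow> Re (\<Gamma> w) \<le> 0 \<Longrightarrow> w = v"
    and "real (card {w \<in> subtree v. cmod (\<Gamma> w - q) < rad w}) \<le> 2 * log 2 (card (subtree v))"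
  using assms unfolding good_drawing_def by simp_all

text \<open>A single vertex is allowed no ply at all, as \<open>2 * log 2 1 = 0\<close>. Radius 0
  makes its disk empty; the arc into it is accounted for one level up.\<close>

lemma good_drawing_leaf:
  assumes "E `` {v} = {}"
  shows "good_drawing v (\<lambda>_. 0) (\<lambda>_. 0)"
proof -
  have "subtree v = {v}" using subtree_unfold [of v] assms by simp
  thus ?thesis using assms drawing_radius_ge [of 1] by (auto simp: good_drawing_def)
qed

end

section \<open>Assembling the drawing along a heavy path\<close>

locale heavy_path = quinary_forest E + smoothed_gaps d \<rho>
  for E :: "('a \<times> 'a) set" and d \<rho> :: "nat \<Rightarrow> real" +
  fixes p :: "nat \<Rightarrow> 'a" and m :: nat and \<omega> :: "nat \<Rightarrow> 'a \<Rightarrow> complex"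
    and G :: "'a \<Rightarrow> 'a \<Rightarrow> complex" and R :: "'a \<Rightarrow> 'a \<Rightarrow> real"
  assumes path: "i < m \<Longrightarrow> (p i, p (Suc i)) \<in> E"
    and path_end: "E `` {p m} = {}"
    and path_nontrivial: "0 < m"
    and \<omega>_hex: "i \<le> m \<Longrightarrow> s \<in> E `` {p i} - {p (Suc i)} \<Longrightarrow> \<omega> i s \<in> hex_directions"
    and \<omega>_inj: "i \<le> m \<Longrightarrow> inj_on (\<omega> i) (E `` {p i} - {p (Suc i)})"
    and good_light: "i \<le> m \<Longrightarrow> s \<in> E `` {p i} - {p (Suc i)} \<Longrightarrow> good_drawing s (G s) (R s)"
    and light_radius: "i \<le> m \<Longrightarrow> s \<in> E `` {p i} - {p (Suc i)} \<Longrightarrow>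
      drawing_radius (card (subtree s)) \<le> \<rho> i"
    and light_card: "i \<le> m \<Longrightarrow> s \<in> E `` {p i} - {p (Suc i)} \<Longrightarrow>
      2 * card (subtree s) \<le> card (subtree (p 0))"
    and width: "x (Suc (Suc m)) \<le> drawing_radius (card (subtree (p 0)))"
begin

definition light :: "nat \<Rightarrow> 'a \<Rightarrow> bool" where
  "light i s \<longleftrightarrow> i \<le> m \<and> s \<in> E `` {p i} - {p (Suc i)}"

text \<open>\<open>p m\<close> is a leaf, so a light child forces \<open>i < m\<close>, and
  \<open>p (Suc i)\<close> is then a true child of \<open>p i\<close>.\<close>

lemma lightD:
  assumes "light i s"
  shows "i < m" "(p i, s) \<in> E" "s \<noteq> p (Suc i)" "\<omega> i s \<in> hex_directions"
    "good_drawing s (G s) (R s)" "drawing_radius (card (subtree s)) \<le> \<rho> i"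
    "2 * card (subtree s) \<le> card (subtree (p 0))"
  using assms path_end \<omega>_hex [of i s] good_light [of i s] light_radius [of i s] light_card [of i s]
  by (auto simp: light_def order_le_less)

lemma path_in_subtree: "i \<le> j \<Longrightarrow> j \<le> m \<Longrightarrow> p j \<in> subtree (p i)"
  by (induction j rule: dec_induct) (use child_in_subtree path in \<open>auto simp: Suc_le_eq\<close>)

lemma path_inj: "i \<le> m \<Longrightarrow> j \<le> m \<Longrightarrow> p i = p j \<Longrightarrow> i = j"
proof (induction i j rule: linorder_wlog)
  case (le i j)
  show ?case
  proof (rule ccontr)
    assume "i \<noteq> j"
    with le have "i < m" "p j \<in> subtree (p (Suc i))" by (auto intro!: path_in_subtree)
    thus False using not_in_subtree_child [OF path [of i]] le by simp
  qed
qed auto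

lemma light_subtree_disjoint_path_tail:
  "light i s \<Longrightarrow> subtree s \<inter> subtree (p (Suc i)) = {}"
  using sibling_subtrees_disjoint lightD path by blast

lemma path_not_in_light: "light i s \<Longrightarrow> j \<le> m \<Longrightarrow> p j \<notin> subtree s"
proof
  assume l: "light i s" and j: "j \<le> m" "p j \<in> subtree s"
  show False
  proof (cases "i < j")
    case True
    thus False using path_in_subtree [of "Suc i" j] light_subtree_disjoint_path_tail [OF l] j by auto
  next
    case False
    hence "p i \<in> subtree (p j)" using lightD(1) [OF l] by (intro path_in_subtree) auto
    hence "p i \<in> subtree s" using j subtree_mono by blast
    thus False using not_in_subtree_child lightD(2) [OF l] by blast
  qed
qed

lemma light_subtrees_disjoint:
  assumes "light i s" "light j t" "w \<in> subtree s" "w \<in> subtree t"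
  shows "i = j \<and> s = t"
proof -
  have False if l: "light i s" "light j t" "w \<in> subtree s" "w \<in> subtree t" "i < j" for i j s t
  proof -
    have "p j \<in> subtree (p (Suc i))" using that lightD(1) [OF l(2)] by (intro path_in_subtree) auto
    hence "w \<in> subtree (p (Suc i))"
      using subtree_mono subtree_child_subset lightD(2) [OF l(2)] l(4) by blast
    thus False using light_subtree_disjoint_path_tail [OF l(1)] l(3) by blast
  qed
  hence ij: "i = j" using assms by (metis linorder_neqE_nat)
  moreover have "s = t" using sibling_subtrees_disjoint assms lightD(2) ij by fastforce
  ultimately show ?thesis by simp
qed

lemma subtree_decomposition:
  assumes "w \<in> subtree (p 0)"
  obtains (path) i where "i \<le> m" "w = p i"
  | (light) i s where "light i s" "w \<in> subtree s"
proof -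
  have "(\<exists>i\<le>m. w = p i) \<or> (\<exists>i s. light i s \<and> w \<in> subtree s)"
    if "w \<in> subtree (p k)" "k \<le> m" for k
    using that
  proof (induction "m - k" arbitrary: k)
    case 0
    hence "k = m" by simp
    thus ?case using 0 subtree_unfold [of "p m"] path_end by auto
  next
    case (Suc l)
    from Suc.prems(1) subtree_unfold [of "p k"] consider "w = p k" | c where "(p k, c) \<in> E" "w \<in> subtree c"
      by auto
    thus ?case
    proof cases
      case (2 c)
      show ?thesis
      proof (cases "c = p (Suc k)")
        case True
        thus ?thesis using Suc.hyps(1) [of "Suc k"] Suc.hyps(2) 2 by simp
      next
        case False
        thus ?thesis using 2 Suc.prems by (auto simp: light_def)
      qed
    qed (use Suc.prems in auto)
  qed
  from this [of 0] assms show ?thesis using that by auto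
qed

lemma edge_decomposition:
  assumes "(a, b) \<in> E" "a \<in> subtree (p 0)"
  obtains (path) i where "i < m" "a = p i" "b = p (Suc i)"
  | (spoke) i where "light i b" "a = p i"
  | (light) i s where "light i s" "a \<in> subtree s" "b \<in> subtree s"
  using assms(2)
proof (cases rule: subtree_decomposition)
  case (path i)
  have "i < m" using path path_end assms by (auto simp: order_le_less)
  show ?thesis
  proof (cases "b = p (Suc i)")
    case True
    thus ?thesis using that(1) path \<open>i < m\<close> by blast
  next
    case False
    thus ?thesis using that(2) path assms(1) by (simp add: light_def)
  qed
next
  case (light i s)
  thus ?thesis using that(3) child_in_subtree assms(1) by blast
qed

text \<open>The chosen pair is unique by \<open>light_subtrees_disjoint\<close>. Multiplication by
  the unit number \<open>\<omega> i s\<close> turns the recursive drawing so that its negative real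
  axis points from \<open>s\<close> back to \<open>p i\<close>.\<close>

definition \<Gamma> :: "'a \<Rightarrow> complex" where
  "\<Gamma> w = (if w \<in> p ` {..m} then of_real (x (the_inv_into {..m} p w))
     else let (i, s) = (SOME (i, s). light i s \<and> w \<in> subtree s)
       in centre i (\<omega> i s) + \<omega> i s * G s w)"

text \<open>At a light child \<open>s\<close> the spoke, of length \<open>2 * \<rho> i\<close>,
  dominates the arcs inside the module, so \<open>\<rho> i\<close> replaces
  \<open>R s s\<close>.\<close>

definition rad :: "'a \<Rightarrow> real" where
  "rad w = (if w \<in> p ` {..m} then r (the_inv_into {..m} p w)
     else let (i, s) = (SOME (i, s). light i s \<and> w \<in> subtree s)
       in if w = s then \<rho> i else R s w)"

lemma path_index: "i \<le> m \<Longrightarrow> the_inv_into {..m} p (p i) = i"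
  by (rule the_inv_into_f_f) (auto simp: inj_on_def path_inj)

lemma \<Gamma>_path: "i \<le> m \<Longrightarrow> \<Gamma> (p i) = of_real (x i)"
  by (auto simp: \<Gamma>_def path_index)

lemma rad_path: "i \<le> m \<Longrightarrow> rad (p i) = r i"
  by (auto simp: rad_def path_index)

lemma light_index:
  assumes "light i s" "w \<in> subtree s"
  shows "(SOME (i, s). light i s \<and> w \<in> subtree s) = (i, s)" "w \<notin> p ` {..m}"
proof -
  show "(SOME (i, s). light i s \<and> w \<in> subtree s) = (i, s)"
    by (rule some_equality) (use assms light_subtrees_disjoint in auto)
  show "w \<notin> p ` {..m}" using assms path_not_in_light by auto
qed

lemma \<Gamma>_light: "light i s \<Longrightarrow> w \<in> subtree s \<Longrightarrow> \<Gamma> w = centre i (\<omega> i s) + \<omega> i s * G s w"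
  using light_index [of i s w] unfolding \<Gamma>_def by simp

lemma rad_light: "light i s \<Longrightarrow> w \<in> subtree s \<Longrightarrow> rad w = (if w = s then \<rho> i else R s w)"
  using light_index [of i s w] unfolding rad_def by simp

lemma \<Gamma>_light_root: "light i s \<Longrightarrow> \<Gamma> s = centre i (\<omega> i s)"
  using \<Gamma>_light [of i s s] lightD(5) [of i s] by (simp add: good_drawing_def)

abbreviation in_module :: "nat \<Rightarrow> 'a \<Rightarrow> complex \<Rightarrow> bool" where
  "in_module i s z \<equiv> cmod (z - centre i (\<omega> i s)) < \<rho> i"

lemma module_disjoint:
  assumes "light i s" "light j t" "in_module i s z" "in_module j t z"
  shows "i = j" "s = t"
proof -
  show "i = j" using module_unique(1) [OF lightD(4) [OF assms(1)] lightD(4) [OF assms(2)]] assms by simp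
  moreover have "\<omega> i s = \<omega> j t"
    using module_unique(2) [OF lightD(4) [OF assms(1)] lightD(4) [OF assms(2)]] assms by simp
  ultimately show "s = t" using \<omega>_inj [of i] assms by (auto simp: light_def inj_on_def)
qed

lemma light_dist:
  assumes "light i s" "w \<in> subtree s"
  shows "cmod (\<Gamma> w - centre i (\<omega> i s)) = cmod (G s w)"
  using hex_direction_simps(4) [OF lightD(4) [OF assms(1)]] \<Gamma>_light [OF assms] by (simp add: norm_mult)

lemma light_in_module:
  assumes "light i s" "w \<in> subtree s"
  shows "in_module i s (\<Gamma> w)"
  using lightD(5,6) [OF assms(1)] assms(2) unfolding light_dist [OF assms] good_drawing_def by force

lemma light_disk_bound:
  assumes "light i s" "w \<in> subtree s"
  shows "cmod (\<Gamma> w - centre i (\<omega> i s)) + rad w \<le> \<rho> i"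
proof (cases "w = s")
  case True
  thus ?thesis using assms by (simp add: \<Gamma>_light_root rad_light)
next
  case False
  thus ?thesis using lightD(5,6) [OF assms(1)] assms
    unfolding light_dist [OF assms] good_drawing_def by (force simp: rad_light)
qed

lemma light_disk_in_module:
  assumes "light i s" "w \<in> subtree s" "cmod (\<Gamma> w - q) < rad w"
  shows "in_module i s q"
  using light_disk_bound [OF assms(1,2)] assms(3) norm_triangle_ineq [of "q - \<Gamma> w" "\<Gamma> w - centre i (\<omega> i s)"]
  by (simp add: norm_minus_commute)

lemma light_segment_in_module:
  assumes "light i s" "a \<in> subtree s" "b \<in> subtree s" "z \<in> closed_segment (\<Gamma> a) (\<Gamma> b)"
  shows "in_module i s z"
proof -
  have "closed_segment (\<Gamma> a) (\<Gamma> b) \<subseteq> ball (centre i (\<omega> i s)) (\<rho> i)"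
    using light_in_module [OF assms(1,2)] light_in_module [OF assms(1,3)]
    by (intro closed_segment_subset) (auto simp: dist_norm norm_minus_commute)
  thus ?thesis using assms(4) by (auto simp: dist_norm norm_minus_commute)
qed

lemma \<rho>_light_ge: "light i s \<Longrightarrow> 66 \<le> \<rho> i"
  using lightD(6) drawing_radius_ge [OF card_subtree_pos] by (meson order_trans)

text \<open>The two gaps after \<open>x i\<close> are at least \<open>8/3 * \<rho> i\<close> and
  half of that, together \<open>4 * \<rho> i\<close>, while the module reaches at most
  \<open>3 * \<rho> i\<close> beyond \<open>x i\<close>.\<close>

lemma module_extent: "light i s \<Longrightarrow> cmod (centre i (\<omega> i s)) + \<rho> i \<le> x (Suc (Suc i))"
proof -
  assume l: "light i s"
  have "cmod (centre i (\<omega> i s)) \<le> x i + 2 * \<rho> i"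
    unfolding centre_def using hex_direction_simps(4) [OF lightD(4) [OF l]] x_nonneg [of i] \<rho>_nonneg [of i]
    by (intro norm_triangle_le) (simp add: norm_mult)
  thus ?thesis using gap_half(1) [of "Suc i"] gap_ge(2) [of i] \<rho>_nonneg [of i] by (simp add: x_Suc)
qed

lemma x_le_width: "i \<le> Suc (Suc m) \<Longrightarrow> x i \<le> drawing_radius (card (subtree (p 0)))"
  using x_mono width by (meson order_trans)

lemma drawing_bounds:
  assumes "w \<in> subtree (p 0)"
  shows "cmod (\<Gamma> w) < drawing_radius (card (subtree (p 0)))"
    "cmod (\<Gamma> w) + rad w \<le> drawing_radius (card (subtree (p 0)))"
proof -
  have "cmod (\<Gamma> w) < drawing_radius (card (subtree (p 0))) \<and>
    cmod (\<Gamma> w) + rad w \<le> drawing_radius (card (subtree (p 0)))"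
    using assms
  proof (cases rule: subtree_decomposition)
    case (path i)
    thus ?thesis using x_le_width [of "Suc i"] x_nonneg [of i] r_le(2) [of i] gap_pos [of "Suc i"]
      by (simp add: \<Gamma>_path rad_path x_Suc)
  next
    case (light i s)
    have "cmod (\<Gamma> w) \<le> cmod (centre i (\<omega> i s)) + cmod (\<Gamma> w - centre i (\<omega> i s))"
      by (rule norm_triangle_sub)
    thus ?thesis
      using light_in_module [OF light] light_disk_bound [OF light] module_extent [OF light(1)]
        x_le_width [of "Suc (Suc i)"] lightD(1) [OF light(1)] by simp
  qed
  thus "cmod (\<Gamma> w) < drawing_radius (card (subtree (p 0)))"
    "cmod (\<Gamma> w) + rad w \<le> drawing_radius (card (subtree (p 0)))" by auto
qed

lemma \<Gamma>_inj: "inj_on \<Gamma> (subtree (p 0))"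
proof (rule inj_onI)
  fix v w assume v: "v \<in> subtree (p 0)" and w: "w \<in> subtree (p 0)" and eq: "\<Gamma> v = \<Gamma> w"
  have Im: "Im (\<Gamma> u) \<noteq> 0" if "light i s" "u \<in> subtree s" for u i s
    using module_Im_nonzero [OF lightD(4) light_in_module] that by blast
  show "v = w"
    using v
  proof (cases rule: subtree_decomposition)
    case (path i)
    note v = this
    show ?thesis using w
    proof (cases rule: subtree_decomposition)
      case (path j)
      thus ?thesis using v eq strict_mono_eq [OF x_strict_mono] by (simp add: \<Gamma>_path)
    next
      case light
      thus ?thesis using Im v eq by (metis \<Gamma>_path Im_complex_of_real)
    qed
  next
    case (light i s)
    note v = this
    show ?thesis using w
    proof (cases rule: subtree_decomposition)
      case path
      thus ?thesis using Im v eq by (metis \<Gamma>_path Im_complex_of_real)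
    next
      case (light j t)
      hence "t = s" using module_disjoint(2) [OF v(1) light(1)] light_in_module v eq by metis
      moreover have "j = i" using module_disjoint(1) [OF v(1) light(1)] light_in_module v light eq by metis
      moreover have "inj_on (G s) (subtree s)" using lightD(5) [OF v(1)] by (simp add: good_drawing_def)
      ultimately show ?thesis
        using eq v light hex_direction_rotate(2) [OF lightD(4) [OF v(1)]]
        by (auto simp: \<Gamma>_light inj_on_def)
    qed
  qed
qed

lemma dist_light:
  assumes "light i s" "a \<in> subtree s" "b \<in> subtree s"
  shows "dist (\<Gamma> a) (\<Gamma> b) = dist (G s a) (G s b)"
  using hex_direction_rotate(1) [OF lightD(4) [OF assms(1)]] assms by (simp add: \<Gamma>_light dist_norm)

lemma dist_spoke: "light i s \<Longrightarrow> dist (\<Gamma> (p i)) (\<Gamma> s) = 2 * \<rho> i"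
  using hex_direction_simps(4) [OF lightD(4) [of i s]] lightD(1) [of i s] \<rho>_nonneg [of i]
  by (simp add: \<Gamma>_light_root \<Gamma>_path centre_def dist_norm norm_mult)

lemma edge_bounds:
  assumes "(a, b) \<in> E" "a \<in> subtree (p 0)"
  shows "1 \<le> dist (\<Gamma> a) (\<Gamma> b) \<and> dist (\<Gamma> a) (\<Gamma> b) \<le> 2 * rad a \<and> dist (\<Gamma> a) (\<Gamma> b) \<le> 2 * rad b"
  using assms
proof (cases rule: edge_decomposition)
  case (path i)
  hence "dist (\<Gamma> a) (\<Gamma> b) = d (Suc i)"
    using gap_pos [of "Suc i"] by (simp add: \<Gamma>_path dist_norm x_Suc flip: of_real_diff)
  thus ?thesis using path gap_ge_1 [of "Suc i"] gap_le_r [of i] gap_le_r [of "Suc i"]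
    by (simp add: rad_path)
next
  case (spoke i)
  thus ?thesis using \<rho>_light_ge [OF spoke(1)] \<rho>_le_r [of i] lightD(1) [OF spoke(1)]
    by (simp add: dist_spoke rad_path rad_light)
next
  case (light i s)
  have g: "1 \<le> dist (G s a) (G s b) \<and> dist (G s a) (G s b) \<le> 2 * R s a \<and> dist (G s a) (G s b) \<le> 2 * R s b"
    using lightD(5) [OF light(1)] light assms(1) unfolding good_drawing_def by blast
  \<comment> \<open>Handles an endpoint equal to \<open>s\<close>, where \<open>rad\<close> is
    \<open>\<rho> i\<close>.\<close>
  have "dist (\<Gamma> a) (\<Gamma> b) \<le> 2 * \<rho> i"
    using light_in_module [OF light(1,2)] light_in_module [OF light(1,3)]
      dist_triangle2 [of "\<Gamma> a" "\<Gamma> b" "centre i (\<omega> i s)"] by (simp add: dist_norm)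
  thus ?thesis using g light by (auto simp: dist_light rad_light)
qed

text \<open>Path arcs lie on the real axis, which all modules miss. A spoke meets no module but its
  own. An arc inside a module stays there by convexity, and the recursive drawing takes care of
  it.\<close>

lemma no_vertex_on_edge:
  assumes "(a, b) \<in> E" "a \<in> subtree (p 0)" "w \<in> subtree (p 0)" "\<Gamma> w \<in> closed_segment (\<Gamma> a) (\<Gamma> b)"
  shows "w = a \<or> w = b"
  using assms(1,2)
proof (cases rule: edge_decomposition)
  case (path i)
  from assms(4) path obtain u where u: "0 \<le> u" "u \<le> 1" "\<Gamma> w = of_real ((1 - u) * x i + u * x (Suc i))"
    by (auto simp: \<Gamma>_path in_segment scaleR_conv_of_real)
  show ?thesis using assms(3)
  proof (cases rule: subtree_decomposition)
    case (path j)
    hence xj: "x j = x i + u * d (Suc i)" using u by (simp add: \<Gamma>_path x_Suc algebra_simps del: of_real_mult of_real_add)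
    have "0 \<le> u * d (Suc i)" "u * d (Suc i) \<le> d (Suc i)"
      using u gap_pos [of "Suc i"] by (auto intro: mult_left_le_one_le)
    with xj have "x i \<le> x j" "x j \<le> x (Suc i)" by (simp_all add: x_Suc)
    hence "j = i \<or> j = Suc i" using x_strict_mono by (auto simp: strict_mono_less_eq)
    thus ?thesis using path \<open>a = p i\<close> \<open>b = p (Suc i)\<close> by auto
  next
    case (light j s)
    thus ?thesis using module_Im_nonzero [OF lightD(4) [OF light(1)] light_in_module [OF light]] u by simp
  qed
next
  case (spoke i)
  note \<omega> = lightD(4) [OF spoke(1)]
  from assms(4) spoke obtain u where u: "0 \<le> u" "u \<le> 1"
      "\<Gamma> w = of_real (x i) + of_real (2 * u * \<rho> i) * \<omega> i b"
    using lightD(1) [OF spoke(1)]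
    by (auto simp: \<Gamma>_path \<Gamma>_light_root in_segment scaleR_conv_of_real centre_def algebra_simps)
  show ?thesis using assms(3)
  proof (cases rule: subtree_decomposition)
    case (path j)
    have "Im (\<omega> i b) \<noteq> 0" using hex_direction_simps(2) [OF \<omega>] by auto
    moreover have "Im (\<Gamma> w) = 0" using path by (simp add: \<Gamma>_path)
    ultimately have "u * \<rho> i = 0" using u(3) by simp
    hence "x j = x i" using u(3) path by (auto simp: \<Gamma>_path)
    thus ?thesis using strict_mono_eq [OF x_strict_mono] path spoke by auto
  next
    case (light j s)
    have m: "in_module j s (\<Gamma> w)" using light light_in_module by blast
    have "\<bar>Re (\<Gamma> w) - x i\<bar> = u * \<rho> i"
      using u \<rho>_nonneg [of i] hex_direction_simps(1) [OF \<omega>] by (simp add: abs_mult)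
    also have "\<dots> \<le> 2 * \<rho> i"
      using u \<rho>_nonneg [of i] mult_right_mono [of u 2 "\<rho> i"] by simp
    finally have "\<bar>Re (\<Gamma> w) - x i\<bar> \<le> 2 * \<rho> i" .
    hence j: "j = i"
      using module_slab [OF lightD(4) [OF light(1)] m] slabs_disjoint [of i j] slabs_disjoint [of j i]
      by (cases i j rule: linorder_cases) linarith+
    have "\<omega> i b = \<omega> j s"
    proof (rule ccontr)
      assume "\<omega> i b \<noteq> \<omega> j s"
      hence "\<Gamma> w \<noteq> of_real (x j) + of_real (2 * u * \<rho> i) * \<omega> i b"
        by (rule module_misses_spoke [OF lightD(4) [OF light(1)] m \<omega>])
          (use u \<rho>_nonneg [of i] in auto)
      thus False using u(3) j by blast
    qed
    hence s: "s = b" using \<omega>_inj [of i] light spoke j by (auto simp: light_def inj_on_def)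
    \<comment> \<open>In the coordinates of the recursive drawing the spoke runs along the negative
      real axis, where only \<open>b\<close> is drawn.\<close>
    have "\<omega> i b * G b w = \<omega> i b * of_real (2 * (u - 1) * \<rho> i)"
      using u(3) \<Gamma>_light [OF light] j s by (simp add: centre_def algebra_simps)
    hence "G b w = of_real (2 * (u - 1) * \<rho> i)"
      using hex_direction_rotate(2) [OF \<omega>] by blast
    moreover have "2 * (u - 1) * \<rho> i \<le> 0" by (rule mult_nonpos_nonneg) (use u \<rho>_nonneg [of i] in auto)
    ultimately have "Im (G b w) = 0" "Re (G b w) \<le> 0" by simp_all
    moreover have "\<forall>w\<in>subtree b. Im (G b w) = 0 \<longrightarrow> Re (G b w) \<le> 0 \<longrightarrow> w = b"
      using lightD(5) [OF spoke(1)] by (simp add: good_drawing_def)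
    ultimately show ?thesis using light s by blast
  qed
next
  case (light i s)
  have m: "in_module i s (\<Gamma> w)" using light_segment_in_module light assms(4) by blast
  show ?thesis using assms(3)
  proof (cases rule: subtree_decomposition)
    case (path j)
    thus ?thesis using module_Im_nonzero [OF lightD(4) [OF light(1)] m] by (simp add: \<Gamma>_path)
  next
    case l: (light j t)
    hence "s = t" using module_disjoint(2) [OF light(1) l(1) m] light_in_module by blast
    hence w: "w \<in> subtree s" using l by simp
    from assms(4) obtain u where u: "0 \<le> u" "u \<le> 1" "\<Gamma> w = (1 - u) *\<^sub>R \<Gamma> a + u *\<^sub>R \<Gamma> b"
      by (auto simp: in_segment)
    hence "\<omega> i s * G s w = \<omega> i s * ((1 - u) *\<^sub>R G s a + u *\<^sub>R G s b)"
      using light w by (simp add: \<Gamma>_light scaleR_conv_of_real algebra_simps)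
    hence "G s w = (1 - u) *\<^sub>R G s a + u *\<^sub>R G s b"
      using hex_direction_rotate(2) [OF lightD(4) [OF light(1)]] by blast
    hence "G s w \<in> closed_segment (G s a) (G s b)" using u by (auto simp: in_segment)
    thus ?thesis using lightD(5) [OF light(1)] light w assms(1) unfolding good_drawing_def by blast
  qed
qed

lemma negative_axis_free:
  assumes "w \<in> subtree (p 0)" "Im (\<Gamma> w) = 0" "Re (\<Gamma> w) \<le> 0"
  shows "w = p 0"
  using assms(1)
proof (cases rule: subtree_decomposition)
  case (path i)
  thus ?thesis using assms strict_mono_less_eq [OF x_strict_mono, of i 0] by (simp add: \<Gamma>_path)
next
  case (light i s)
  thus ?thesis using module_Im_nonzero [OF lightD(4) light_in_module] assms by blast
qed

lemma card_subtree_ge_2: "2 \<le> card (subtree (p 0))"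
  using card_subtree_child [OF path [OF path_nontrivial]] card_subtree_pos [of "p (Suc 0)"] by linarith

text \<open>A point in a module is covered only by the disk of \<open>p i\<close> and by disks of
  that light subtree, and 2 + 2 log k = 2 log (2 k) \<le> 2 log n for its size k. Any other point is
  covered only by path disks, whose indices are confined to two consecutive values by
  \<open>far_path_disks\<close>.\<close>

lemma ply_bound:
  "real (card {w \<in> subtree (p 0). cmod (\<Gamma> w - q) < rad w}) \<le> 2 * log 2 (card (subtree (p 0)))"
proof -
  let ?n = "card (subtree (p 0))"
  let ?S = "{w \<in> subtree (p 0). cmod (\<Gamma> w - q) < rad w}"
  show ?thesis
  proof (cases "\<exists>i s. light i s \<and> in_module i s q")
    case True
    then obtain i s where l: "light i s" and q: "in_module i s q" by blast
    define q' where "q' = (q - centre i (\<omega> i s)) / \<omega> i s"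
    let ?S' = "{w \<in> subtree s. cmod (G s w - q') < R s w}"
    have nz: "\<omega> i s \<noteq> 0" using hex_direction_simps(4) [OF lightD(4) [OF l]] by auto
    \<comment> \<open>\<open>s\<close> is listed separately, as the arc from \<open>p i\<close> enlarges its radius.\<close>
    have "?S \<subseteq> insert (p i) (insert s ?S')"
    proof
      fix w assume "w \<in> ?S"
      hence w: "w \<in> subtree (p 0)" "cmod (\<Gamma> w - q) < rad w" by auto
      show "w \<in> insert (p i) (insert s ?S')"
        using w(1)
      proof (cases rule: subtree_decomposition)
        case (path j)
        have "j = i"
          using module_misses_path_disk [OF lightD(4) [OF l] q, of j] w path
          by (cases "j = i") (auto simp: \<Gamma>_path rad_path)
        thus ?thesis using path by simp
      next
        case (light j t)
        have "t = s"
          using module_disjoint(2) [OF light(1) l light_disk_in_module [OF light w(2)] q] .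
        hence ws: "w \<in> subtree s" using light by simp
        have "\<Gamma> w - q = \<omega> i s * G s w - \<omega> i s * q'"
          using \<Gamma>_light [OF l ws] nz by (simp add: q'_def)
        hence "cmod (\<Gamma> w - q) = cmod (G s w - q')"
          using hex_direction_rotate(1) [OF lightD(4) [OF l]] by simp
        thus ?thesis using w(2) ws rad_light [OF l ws] by (cases "w = s") auto
      qed
    qed
    hence "card ?S \<le> card (insert (p i) (insert s ?S'))"
      by (intro card_mono) auto
    also have "\<dots> \<le> 2 + card ?S'"
      by (simp add: card_insert_if)
    finally have "real (card ?S) \<le> 2 + real (card ?S')" by linarith
    also have "real (card ?S') \<le> 2 * log 2 (card (subtree s))"
      using lightD(5) [OF l] by (simp add: good_drawing_def)
    also have "2 + 2 * log 2 (card (subtree s)) = 2 * log 2 (2 * card (subtree s))"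
      using card_subtree_pos [of s] by (subst of_nat_mult, subst log_mult) auto
    also have "\<dots> \<le> 2 * log 2 ?n"
      using lightD(7) [OF l] card_subtree_pos [of s] by (simp flip: of_nat_mult)
    finally show ?thesis by simp
  next
    case False
    define J where "J = {j. j \<le> m \<and> cmod (of_real (x j) - q) < r j}"
    have fin: "finite J" unfolding J_def by auto
    have "?S \<subseteq> p ` J"
    proof
      fix w assume "w \<in> ?S"
      hence w: "w \<in> subtree (p 0)" "cmod (\<Gamma> w - q) < rad w" by auto
      show "w \<in> p ` J"
        using w(1)
      proof (cases rule: subtree_decomposition)
        case (path j)
        thus ?thesis using w by (auto simp: J_def \<Gamma>_path rad_path)
      next
        case light
        thus ?thesis using False light_disk_in_module w(2) by blast
      qed
    qed
    hence "card ?S \<le> card (p ` J)" using fin by (intro card_mono) auto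
    also have "\<dots> \<le> card J" by (rule card_image_le [OF fin])
    also have "\<dots> \<le> 2"
    proof (cases "J = {}")
      case False
      have "j \<in> {Min J, Suc (Min J)}" if "j \<in> J" for j
      proof (rule ccontr)
        assume "\<not> ?thesis"
        with Min_le [OF fin that] have "Suc (Min J) < j" by auto
        from far_path_disks [OF this] have "x (Min J) + r (Min J) \<le> x j - r j" .
        moreover have "x j - x (Min J) \<le> cmod (of_real (x j) - q) + cmod (of_real (x (Min J)) - q)"
          using norm_triangle_ineq4 [of "of_real (x j) - q" "of_real (x (Min J)) - q"]
          by (simp flip: of_real_diff)
        ultimately show False using Min_in [OF fin False] that by (auto simp: J_def)
      qed
      hence "J \<subseteq> {Min J, Suc (Min J)}" by blast
      thus ?thesis using card_mono [of "{Min J, Suc (Min J)}" J] by simp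
    qed simp
    finally have "real (card ?S) \<le> 2" by simp
    \<comment> \<open>The path has at least one arc, so n \<ge> 2 and the logarithm is at least
      1.\<close>
    also have "\<dots> \<le> 2 * log 2 ?n"
      using card_subtree_ge_2 by (simp add: le_log_iff)
    finally show ?thesis .
  qed
qed

lemma good_drawing_heavy_path: "good_drawing (p 0) \<Gamma> rad"
  unfolding good_drawing_def
  using drawing_bounds \<Gamma>_inj edge_bounds no_vertex_on_edge negative_axis_free ply_bound
  by (auto simp: \<Gamma>_path)

end

section \<open>Recursion over the light subtrees\<close>

context quinary_forest
begin

text \<open>One of the at most five children continues the path, which leaves at most four for the
  four directions.\<close>

lemma hex_directions_assignment:
  assumes "E `` {a} \<noteq> {} \<Longrightarrow> h \<in> E `` {a}"
  shows "\<exists>\<omega>. (\<forall>s\<in>E `` {a} - {h}. \<omega> s \<in> hex_directions) \<and> inj_on \<omega> (E `` {a} - {h})"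
proof -
  have "card (E `` {a} - {h}) \<le> card hex_directions"
    using assms card_children [of a] by (cases "E `` {a} = {}") (auto simp: card_Diff_singleton card_hex_directions)
  then obtain \<omega> where "inj_on \<omega> (E `` {a} - {h})" "\<omega> ` (E `` {a} - {h}) \<subseteq> hex_directions"
    using inj_on_iff_card_le [of "E `` {a} - {h}" hex_directions] card_hex_directions by auto
  thus ?thesis by blast
qed

lemma good_drawing_exists: "\<exists>\<Gamma> rad. good_drawing v \<Gamma> rad"
proof (induction "card (subtree v)" arbitrary: v rule: less_induct)
  case less
  show ?case
  proof (cases "E `` {v} = {}")
    case True
    thus ?thesis using good_drawing_leaf by blast
  next
    case False
    let ?n = "card (subtree v)"
    from heavy_path_exists [of v] obtain p m where p: "p 0 = v" "\<forall>i<m. (p i, p (Suc i)) \<in> E"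
      "E `` {p m} = {}" "m < ?n" "\<forall>i\<le>m. 2 * max_light (p i) (p (Suc i)) \<le> ?n"
      "11 * (\<Sum>i\<le>m. real (max_light (p i) (p (Suc i))) powr 3.6) \<le> real ?n powr 3.6"
      by blast
    define \<rho> where "\<rho> i = (if i \<le> m then drawing_radius (max_light (p i) (p (Suc i))) else 0)" for i
    obtain d where d: "\<And>i. 1 \<le> d i" "\<And>i. d i / 2 + 2 * \<rho> (Suc i) \<le> d (Suc i)"
      "\<And>i. d (Suc (Suc i)) / 2 + 2 * \<rho> i \<le> d (Suc i)" "d (Suc 0) / 2 \<le> d 0" "8/3 * \<rho> 0 \<le> d 0"
      "\<And>i. 8/3 * \<rho> i + 8/3 * \<rho> (Suc i) \<le> d (Suc i)"
      "(\<Sum>i<Suc (Suc m). d (Suc i)) \<le> real (m + 2) + 32/3 * (\<Sum>i\<le>m. \<rho> i)"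
      by (rule smoothed_gaps_exist [of \<rho> m]) (auto simp: \<rho>_def drawing_radius_nonneg)
    interpret smoothed_gaps d \<rho>
      by unfold_locales (use d in \<open>auto simp: \<rho>_def drawing_radius_nonneg\<close>)
    have "\<forall>i. \<exists>\<omega>. i \<le> m \<longrightarrow>
        (\<forall>s\<in>E `` {p i} - {p (Suc i)}. \<omega> s \<in> hex_directions) \<and> inj_on \<omega> (E `` {p i} - {p (Suc i)})"
    proof
      fix i
      show "\<exists>\<omega>. i \<le> m \<longrightarrow>
        (\<forall>s\<in>E `` {p i} - {p (Suc i)}. \<omega> s \<in> hex_directions) \<and> inj_on \<omega> (E `` {p i} - {p (Suc i)})"
        using hex_directions_assignment [of "p i" "p (Suc i)"] p(2,3)
        by (cases "i < m") (auto simp: order_le_less)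
    qed
    then obtain \<omega> where \<omega>: "\<And>i. i \<le> m \<Longrightarrow>
        (\<forall>s\<in>E `` {p i} - {p (Suc i)}. \<omega> i s \<in> hex_directions) \<and> inj_on (\<omega> i) (E `` {p i} - {p (Suc i)})"
      by metis
    have small: "2 * card (subtree s) \<le> ?n" "drawing_radius (card (subtree s)) \<le> \<rho> i"
      if "i \<le> m" "s \<in> E `` {p i} - {p (Suc i)}" for i s
      using that card_le_max_light [of "p i" s "p (Suc i)"] p(5)
      by (force simp: \<rho>_def intro!: drawing_radius_mono)+
    have "\<forall>s. \<exists>G R. card (subtree s) < ?n \<longrightarrow> good_drawing s G R" using less by blast
    then obtain G R where GR: "\<And>s. card (subtree s) < ?n \<Longrightarrow> good_drawing s (G s) (R s)" by metis
    have "(\<Sum>i\<le>m. \<rho> i) = 66 * (\<Sum>i\<le>m. real (max_light (p i) (p (Suc i))) powr 3.6)"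
      by (simp add: \<rho>_def drawing_radius_def sum_distrib_left)
    \<comment> \<open>Here 6 = 66/11, and then 32/3 * 6 = 64 leaves
      \<open>2 * real ?n powr 3.6\<close> for the unit part of the gaps.\<close>
    also have "\<dots> \<le> 6 * real ?n powr 3.6" using p(6) by simp
    finally have "x (Suc (Suc m)) \<le> real (m + 2) + 64 * real ?n powr 3.6"
      using d(7) unfolding x_def by linarith
    also have "real (m + 2) \<le> 2 * real ?n powr 3.6"
    proof -
      have "real ?n powr 1 \<le> real ?n powr 3.6"
        using card_subtree_pos [of v] by (intro powr_mono) auto
      moreover have "m + 2 \<le> 2 * ?n" using p(4) by linarith
      ultimately show ?thesis using card_subtree_pos [of v] by simp
    qed
    finally have width: "x (Suc (Suc m)) \<le> drawing_radius ?n"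
      by (simp add: drawing_radius_def)
    interpret heavy_path E d \<rho> p m \<omega> G R
    proof unfold_locales
      show "0 < m" using p(1,3) False by (cases m) auto
      fix i s assume i: "i \<le> m" "s \<in> E `` {p i} - {p (Suc i)}"
      show "good_drawing s (G s) (R s)"
        using small(1) [OF i] card_subtree_pos [of s] by (intro GR) simp
    qed (use p \<omega> small width in auto)
    show ?thesis using good_drawing_heavy_path p(1) by blast
  qed
qed

end

section \<open>Transfer to digraphs in the plane\<close>

text \<open>The layout rotates by complex multiplication; this linear isometry carries it over to
  \<open>real^2\<close>.\<close>

definition plane_of_complex :: "complex \<Rightarrow> real^2" where
  "plane_of_complex z = vector [Re z, Im z]"

lemma linear_plane_of_complex: "linear plane_of_complex"
  by (rule linearI) (auto simp: plane_of_complex_def vec_eq_iff forall_2)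

lemma norm_plane_of_complex: "norm (plane_of_complex z) = cmod z"
  by (simp add: plane_of_complex_def norm_vec_def L2_set_def sum_2 cmod_def)

lemma plane_of_complex_diff: "plane_of_complex a - plane_of_complex b = plane_of_complex (a - b)"
  using linear_diff [OF linear_plane_of_complex] by simp

lemma dist_plane_of_complex: "dist (plane_of_complex a) (plane_of_complex b) = dist a b"
  by (simp add: dist_norm plane_of_complex_diff norm_plane_of_complex)

lemma inj_plane_of_complex: "inj plane_of_complex"
  by (rule injI) (metis dist_eq_0_iff dist_plane_of_complex)

lemma surj_plane_of_complex: "\<exists>z. plane_of_complex z = q"
  by (rule exI [of _ "Complex (q $ 1) (q $ 2)"])
    (simp add: plane_of_complex_def vec_eq_iff forall_2)

lemma plane_of_complex_segment:
  "plane_of_complex z \<in> closed_segment (plane_of_complex a) (plane_of_complex b)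
     \<longleftrightarrow> z \<in> closed_segment a b"
  using closed_segment_linear_image [OF linear_plane_of_complex, of a b]
    inj_image_mem_iff [OF inj_plane_of_complex] by metis

lemma measure_bounding_box_le:
  fixes S :: "(real^2) set"
  assumes "S \<subseteq> cball 0 \<rho>" "0 \<le> \<rho>"
  shows "measure lborel (bounding_box S) \<le> 4 * \<rho>\<^sup>2"
proof -
  let ?C = "cbox (vector [-\<rho>, -\<rho>]) (vector [\<rho>, \<rho>]) :: (real^2) set"
  have S: "S \<subseteq> ?C"
  proof
    fix z assume "z \<in> S"
    hence "norm z \<le> \<rho>" using assms by auto
    hence "\<bar>z $ i\<bar> \<le> \<rho>" for i using component_le_norm_cart [of z i] by linarith
    thus "z \<in> ?C" by (simp add: mem_box_cart forall_2 abs_le_iff) (metis minus_le_iff)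
  qed
  hence "bounding_box S \<subseteq> ?C" unfolding bounding_box_def by blast
  \<comment> \<open>Closedness makes the bounding box measurable, as monotonicity of the measure
    requires.\<close>
  moreover have "closed (bounding_box S)" unfolding bounding_box_def by (intro closed_Inter) auto
  ultimately have "measure lborel (bounding_box S) \<le> measure lborel ?C"
    by (intro measure_mono_fmeasurable) (auto simp: fmeasurable_cbox)
  also have "\<dots> = 4 * \<rho>\<^sup>2"
    using assms(2) by (subst content_cbox_cart) (auto simp: UNIV_2 interval_ne_empty_cart forall_2 power2_eq_square)
  finally show ?thesis .
qed

section \<open>Rooted trees as parent-child relations\<close>

lemma rooted_tree_walk_unique:
  assumes "rooted_tree T r" "pre_digraph.awalk T r p v" "pre_digraph.awalk T r q v"
  shows "p = q"
proof -
  interpret fin_digraph T using assms(1) by (simp add: rooted_tree_def)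
  have "v \<in> verts T" using assms(2) awalk_last_in_verts by blast
  thus ?thesis using assms by (auto simp: rooted_tree_def)
qed

text \<open>The forest axioms come from uniqueness of the walks from the root: a closed walk could
  be appended to a walk reaching its start, and two parents of a vertex would yield two walks to it
  with different last arcs.\<close>

lemma k_ary_tree_quinary_forest:
  assumes "k_ary_tree 5 T r"
  defines "E \<equiv> (\<lambda>e. (tail T e, head T e)) ` arcs T"
  shows "quinary_forest E" "E\<^sup>* `` {r} = verts T"
proof -
  have rt: "rooted_tree T r" using assms by (simp add: k_ary_tree_def)
  interpret fin_digraph T using rt by (simp add: rooted_tree_def)
  have snoc: "awalk u (p @ [e]) (head T e)" if "awalk u p (tail T e)" "e \<in> arcs T" for u p e
    using that(1) arc_implies_awalk [OF that(2)] by (rule awalk_appendI)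
  have walk: "\<exists>p. awalk r p v" if "v \<in> verts T" for v using rt that by (auto simp: rooted_tree_def)
  have path: "\<exists>p. awalk a p b \<and> p \<noteq> []" if "(a, b) \<in> E\<^sup>+" for a b
    using that
  proof (induction rule: trancl_induct)
    case (base b)
    then obtain e where "e \<in> arcs T" "a = tail T e" "b = head T e" by (auto simp: E_def)
    thus ?case using arc_implies_awalk by auto
  next
    case (step b c)
    then obtain e p where "e \<in> arcs T" "b = tail T e" "c = head T e" "awalk a p b" by (auto simp: E_def)
    hence "awalk a (p @ [e]) c" using snoc by simp
    thus ?case by blast
  qed
  show "quinary_forest E"
  proof
    show "finite E" by (simp add: E_def)
    show "acyclic E"
    proof (rule acyclicI, intro allI notI)
      fix v assume "(v, v) \<in> E\<^sup>+"
      then obtain p where p: "awalk v p v" "p \<noteq> []" using path by blast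
      then obtain q where "awalk r q v" using walk awalk_hd_in_verts by blast
      moreover from this have "awalk r (q @ p) v" using p by (blast intro: awalk_appendI)
      ultimately have "q = q @ p" using rooted_tree_walk_unique [OF rt] by blast
      with p show False by simp
    qed
    show "a = b" if "(a, c) \<in> E" "(b, c) \<in> E" for a b c
    proof -
      from that obtain e e' where e: "e \<in> arcs T" "a = tail T e" "c = head T e"
        "e' \<in> arcs T" "b = tail T e'" "c = head T e'" by (auto simp: E_def)
      then obtain p p' where "awalk r p a" "awalk r p' b"
        using walk tail_in_verts by metis
      hence "awalk r (p @ [e]) c" "awalk r (p' @ [e']) c"
        using e snoc [of r p e] snoc [of r p' e'] by auto
      hence "p @ [e] = p' @ [e']" using rooted_tree_walk_unique [OF rt] by blast
      with e show ?thesis by simp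
    qed
    show "card (E `` {a}) \<le> 5" for a
    proof (cases "a \<in> verts T")
      case True
      have "E `` {a} = head T ` out_arcs T a" by (auto simp: E_def out_arcs_def)
      hence "card (E `` {a}) \<le> out_degree T a" unfolding out_degree_def by (simp add: card_image_le out_arcs_def)
      also have "\<dots> \<le> 5" using assms(1) True by (simp add: k_ary_tree_def)
      finally show ?thesis .
    next
      case False
      hence "E `` {a} = {}" by (auto simp: E_def)
      thus ?thesis by simp
    qed
  qed
  show "E\<^sup>* `` {r} = verts T"
  proof
    have "v \<in> verts T" if "(r, v) \<in> E\<^sup>*" for v
      using that by (cases rule: rtranclE) (use rt in \<open>auto simp: E_def rooted_tree_def\<close>)
    thus "E\<^sup>* `` {r} \<subseteq> verts T" by blast
    have "(a, b) \<in> E\<^sup>*" if "awalk a p b" for a p b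
      using that
    proof (induction p arbitrary: a)
      case (Cons e p)
      hence "(a, head T e) \<in> E" "(head T e, b) \<in> E\<^sup>*" by (auto simp: awalk_Cons_iff E_def)
      thus ?case by (rule converse_rtrancl_into_rtrancl)
    qed (auto simp: awalk_Nil_iff)
    thus "verts T \<subseteq> E\<^sup>* `` {r}" using walk by blast
  qed
qed

lemma k_ary_tree_drawing:
  fixes T :: "('a, 'b) pre_digraph"
  assumes T: "k_ary_tree 5 T r"
  shows "\<exists>\<Gamma>. straight_line_drawing T \<Gamma> \<and> satisfies_resolution_rule T \<Gamma> \<and>
    real (ply_number T \<Gamma>) \<le> 2 * log 2 (real (card (verts T))) \<and>
    drawing_area T \<Gamma> \<le> 4 * (drawing_radius (card (verts T)))\<^sup>2"
proof -
  interpret fin_digraph T using T by (simp add: k_ary_tree_def rooted_tree_def)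
  define E where "E = (\<lambda>e. (tail T e, head T e)) ` arcs T"
  interpret quinary_forest E unfolding E_def by (rule k_ary_tree_quinary_forest [OF T])
  have V: "subtree r = verts T"
    unfolding subtree_def unfolding E_def by (rule k_ary_tree_quinary_forest [OF T])
  obtain G rad where "good_drawing r G rad" using good_drawing_exists by blast
  note G = good_drawingD [OF this, unfolded V]
  let ?n = "card (verts T)"
  define \<Gamma> where "\<Gamma> v = plane_of_complex (G v)" for v
  have arc: "(tail T e, head T e) \<in> E" if "e \<in> arcs T" for e using that by (simp add: E_def)
  have len: "edge_length T \<Gamma> e = dist (G (tail T e)) (G (head T e))" for e
    by (simp add: edge_length_def \<Gamma>_def dist_plane_of_complex)
  have edge: "1 \<le> edge_length T \<Gamma> e \<and> edge_length T \<Gamma> e \<le> 2 * rad (tail T e) \<and>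
      edge_length T \<Gamma> e \<le> 2 * rad (head T e)" if "e \<in> arcs T" for e
    unfolding len by (rule G(5) [OF arc [OF that] tail_in_verts [OF that]])
  have "inj_on \<Gamma> (verts T)"
    using G(4) inj_plane_of_complex unfolding \<Gamma>_def by (simp add: inj_on_def)
  moreover have "v = tail T e \<or> v = head T e"
    if "e \<in> arcs T" "v \<in> verts T" "\<Gamma> v \<in> edge_segment T \<Gamma> e" for e v
    using that(3) unfolding edge_segment_def \<Gamma>_def plane_of_complex_segment
    by (rule G(6) [OF arc [OF that(1)] tail_in_verts [OF that(1)] that(2)])
  ultimately have "straight_line_drawing T \<Gamma>" by (simp add: straight_line_drawing_def)
  moreover have "satisfies_resolution_rule T \<Gamma>"
    using edge by (simp add: satisfies_resolution_rule_def)
  moreover have "real (ply_number T \<Gamma>) \<le> 2 * log 2 (real ?n)"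
  proof -
    \<comment> \<open>\<open>rad\<close> bounds every positive ply-radius; a vertex of ply-radius 0
      has an empty disk and covers no point.\<close>
    have radius: "v \<in> verts T \<and> norm (\<Gamma> v - q) < rad v"
      if "v \<in> verts T" "norm (\<Gamma> v - q) < ply_radius T \<Gamma> v" for v q
    proof -
      have fin: "finite (insert 0 (edge_length T \<Gamma> ` incident_edges T v))"
        by (simp add: incident_edges_def)
      have "Max (insert 0 (edge_length T \<Gamma> ` incident_edges T v)) \<in>
          insert 0 (edge_length T \<Gamma> ` incident_edges T v)"
        by (rule Max_in [OF fin]) simp
      then consider "ply_radius T \<Gamma> v = 0"
        | e where "e \<in> incident_edges T v" "2 * ply_radius T \<Gamma> v = edge_length T \<Gamma> e"
        by (auto simp: ply_radius_def)
      hence "ply_radius T \<Gamma> v = 0 \<or> ply_radius T \<Gamma> v \<le> rad v"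
      proof cases
        case 2
        thus ?thesis using edge [of e] by (auto simp: incident_edges_def)
      qed simp
      thus ?thesis using that norm_ge_zero [of "\<Gamma> v - q"] by linarith
    qed
    have card: "real (card (disks_at T \<Gamma> q)) \<le> 2 * log 2 (real ?n)" for q
    proof -
      obtain z where z: "q = plane_of_complex z" using surj_plane_of_complex by metis
      let ?S = "{v \<in> verts T. cmod (G v - z) < rad v}"
      have "disks_at T \<Gamma> q \<subseteq> ply_disk T \<Gamma> ` ?S"
      proof
        fix D assume "D \<in> disks_at T \<Gamma> q"
        then obtain v where v: "v \<in> verts T" "D = ply_disk T \<Gamma> v"
          "norm (\<Gamma> v - q) < ply_radius T \<Gamma> v"
          by (auto simp: disks_at_def)
        have "norm (\<Gamma> v - q) = cmod (G v - z)"
          by (simp add: z \<Gamma>_def plane_of_complex_diff norm_plane_of_complex)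
        thus "D \<in> ply_disk T \<Gamma> ` ?S" using radius [OF v(1,3)] v by auto
      qed
      hence "card (disks_at T \<Gamma> q) \<le> card (ply_disk T \<Gamma> ` ?S)" by (intro card_mono) auto
      also have "\<dots> \<le> card ?S" by (intro card_image_le) auto
      finally have "real (card (disks_at T \<Gamma> q)) \<le> real (card ?S)" by simp
      also have "\<dots> \<le> 2 * log 2 (real ?n)" by (rule G(8))
      finally show ?thesis .
    qed
    \<comment> \<open>A bound by the number of vertices makes \<open>MAX\<close> an attained
      value.\<close>
    have "finite (range (\<lambda>q. card (disks_at T \<Gamma> q)))"
    proof (rule finite_subset)
      have "disks_at T \<Gamma> q \<subseteq> ply_disk T \<Gamma> ` verts T" for q by (auto simp: disks_at_def)
      thus "range (\<lambda>q. card (disks_at T \<Gamma> q)) \<subseteq> {..card (ply_disk T \<Gamma> ` verts T)}"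
        by (intro image_subsetI) (simp add: card_mono)
    qed simp
    hence "ply_number T \<Gamma> \<in> range (\<lambda>q. card (disks_at T \<Gamma> q))"
      unfolding ply_number_def by (intro Max_in) auto
    thus ?thesis using card by auto
  qed
  moreover have "drawing_area T \<Gamma> \<le> 4 * (drawing_radius ?n)\<^sup>2"
    unfolding drawing_area_def
  proof (rule measure_bounding_box_le)
    have v: "\<Gamma> v \<in> cball 0 (drawing_radius ?n)" if "v \<in> verts T" for v
      using G(2) [OF that] by (simp add: \<Gamma>_def norm_plane_of_complex)
    moreover have "edge_segment T \<Gamma> e \<subseteq> cball 0 (drawing_radius ?n)" if "e \<in> arcs T" for e
      unfolding edge_segment_def using v that by (intro closed_segment_subset) auto
    ultimately show "drawing_points T \<Gamma> \<subseteq> cball 0 (drawing_radius ?n)"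
      unfolding drawing_points_def by blast
  qed (rule drawing_radius_nonneg)
  ultimately show ?thesis by blast
qed

theorem theorem3:
  shows "\<exists>A :: nat \<Rightarrow> real. A \<in> O(\<lambda>n. real n powr 7.2) \<and>
    (\<forall>(T :: ('a, 'b) pre_digraph) r. k_ary_tree 5 T r \<longrightarrow>
      (\<exists>\<Gamma> :: 'a \<Rightarrow> real^2.
        straight_line_drawing T \<Gamma> \<and> satisfies_resolution_rule T \<Gamma> \<and>
        real (ply_number T \<Gamma>) \<le> 2 * log 2 (real (card (verts T))) \<and>
        drawing_area T \<Gamma> \<le> A (card (verts T))))"
proof (rule exI [of _ "\<lambda>n. 4 * (drawing_radius n)\<^sup>2"], intro conjI allI impI)
  \<comment> \<open>17424 = 4 * 66^2, and squaring doubles the exponent 3.6.\<close>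
  have "4 * (drawing_radius n)\<^sup>2 = 17424 * real n powr 7.2" for n
    by (simp add: drawing_radius_def power2_eq_square flip: powr_add)
  thus "(\<lambda>n. 4 * (drawing_radius n)\<^sup>2) \<in> O(\<lambda>n. real n powr 7.2)" by simp
qed (rule k_ary_tree_drawing)

end
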